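(* Let $L$ be a relational language with finitely many relation symbols of every arity greater than one and with finitely or countably many unary relation symbols, and let $\mathbf H$ be a countable unrestricted $L$-structure in which all relations are injective. Then $\mathbf H$ has finite big Ramsey degrees.
   Context: Convention: every structure is countable, has vertex set some $n\in\omega$ or $\omega$ (so it carries the natural order $\le$ of the integers as an enumeration), and all embeddings are embeddings of $L$-structures (injective maps preserving and reflecting every relation) that are moreover monotone with respect to $\le$. For structures $\mathbf A,\mathbf B$, $\binom{\mathbf B}{\mathbf A}$ denotes the set of all such embeddings $\mathbf A\to\mathbf B$. A relation $R$ is injective in $\mathbf A$ if no tuple of $R^{\mathbf A}$ contains a repeated vertex. For a countably infinite structure $\mathbf B$ and a finite substructure $\mathbf A$, the big Ramsey degree of $\mathbf A$ in $\mathbf B$ is the least $\ell\in\omega+1$ such that for every $k\in\omega$ and every colouring $\chi:\binom{\mathbf B}{\mathbf A}\to k$ there is an embedding $f:\mathbf B\to\mathbf B$ such that $\chi$ takes at most $\ell$ values on the embeddings $\mathbf A\to\mathbf B$ whose image lies in $f[B]$. $\mathbf B$ has finite big Ramsey degrees if this number is finite for every finite substructure $\mathbf A$ of $\mathbf B$. An $L$-structure $\mathbf F$ is covered by a relation if there are $R\in L$ and a tuple $\bar x\in R^{\mathbf F}$ containing all vertices of $\mathbf F$. For a family $\mathcal F$ of $L$-structures, $\mathbf A$ is $\mathcal F$-free if no $\mathbf F\in\mathcal F$ embeds into $\mathbf A$. A structure $\mathbf A$ is universal for a class $\mathcal C$ if every member of $\mathcal C$ embeds into $\mathbf A$. An $L$-structure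 $\mathbf A$ is unrestricted if there is a family $\mathcal F$ of finite $L$-structures, each covered by a relation, such that $\mathbf A$ is $\mathcal F$-free and universal for all countable $\mathcal F$-free $L$-structures. *)

theory Defs
  imports "HOL-Library.FuncSet" "HOL-Library.Countable_Set"
begin

text \<open>A relational language is a type of relation symbols together with an arity map.
  An L-structure has vertex set some n = {..<n} or \<omega> = UNIV (carrying the natural order
  of nat), and interprets each symbol R as a set of tuples (lists) of length ar R.\<close>

type_synonym 'r struct = "nat set \<times> ('r \<Rightarrow> nat list set)"

abbreviation verts :: "'r struct \<Rightarrow> nat set" where "verts A \<equiv> fst A"
abbreviation rels :: "'r struct \<Rightarrow> 'r \<Rightarrow> nat list set" where "rels A \<equiv> snd A"

definition wf_struct :: "('r \<Rightarrow> nat) \<Rightarrow> 'r struct \<Rightarrow> bool" where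
  "wf_struct ar A \<longleftrightarrow>
     ((\<exists>n. verts A = {..<n}) \<or> verts A = UNIV) \<and>
     (\<forall>R. \<forall>t \<in> rels A R. length t = ar R \<and> set t \<subseteq> verts A)"

definition finite_struct :: "('r \<Rightarrow> nat) \<Rightarrow> 'r struct \<Rightarrow> bool" where
  "finite_struct ar A \<longleftrightarrow> wf_struct ar A \<and> finite (verts A)"

text \<open>Monotone embeddings (extensional outside the domain, so that each embedding is
  represented by exactly one function).\<close>
definition is_emb :: "('r \<Rightarrow> nat) \<Rightarrow> 'r struct \<Rightarrow> 'r struct \<Rightarrow> (nat \<Rightarrow> nat) \<Rightarrow> bool" where
  "is_emb ar A B f \<longleftrightarrow>
     f \<in> extensional (verts A) \<and>
     f ` verts A \<subseteq> verts B \<and>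
     inj_on f (verts A) \<and>
     mono_on (verts A) f \<and>
     (\<forall>R. \<forall>t. length t = ar R \<and> set t \<subseteq> verts A \<longrightarrow>
          (t \<in> rels A R \<longleftrightarrow> map f t \<in> rels B R))"

definition embs :: "('r \<Rightarrow> nat) \<Rightarrow> 'r struct \<Rightarrow> 'r struct \<Rightarrow> (nat \<Rightarrow> nat) set" where
  "embs ar A B = {f. is_emb ar A B f}"

definition injective_rel :: "'r struct \<Rightarrow> 'r \<Rightarrow> bool" where
  "injective_rel A R \<longleftrightarrow> (\<forall>t \<in> rels A R. distinct t)"

definition covered_by_relation :: "'r struct \<Rightarrow> bool" where
  "covered_by_relation F \<longleftrightarrow> (\<exists>R. \<exists>t \<in> rels F R. set t = verts F)"

definition free_of :: "('r \<Rightarrow> nat) \<Rightarrow> 'r struct set \<Rightarrow> 'r struct \<Rightarrow> bool" where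
  "free_of ar \<F> A \<longleftrightarrow> (\<forall>F \<in> \<F>. embs ar F A = {})"

definition unrestricted :: "('r \<Rightarrow> nat) \<Rightarrow> 'r struct \<Rightarrow> bool" where
  "unrestricted ar H \<longleftrightarrow>
     (\<exists>\<F>. (\<forall>F \<in> \<F>. finite_struct ar F \<and> covered_by_relation F) \<and>
          free_of ar \<F> H \<and>
          (\<forall>A. wf_struct ar A \<and> free_of ar \<F> A \<longrightarrow> embs ar A H \<noteq> {}))"

definition big_ramsey_le :: "('r \<Rightarrow> nat) \<Rightarrow> 'r struct \<Rightarrow> 'r struct \<Rightarrow> nat \<Rightarrow> bool" where
  "big_ramsey_le ar A B l \<longleftrightarrow>
     (\<forall>(k::nat) (\<chi> :: (nat \<Rightarrow> nat) \<Rightarrow> nat).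
        (\<forall>e \<in> embs ar A B. \<chi> e < k) \<longrightarrow>
        (\<exists>f \<in> embs ar B B.
           card (\<chi> ` {e \<in> embs ar A B. e ` verts A \<subseteq> f ` verts B}) \<le> l))"

definition finite_big_ramsey_degrees :: "('r \<Rightarrow> nat) \<Rightarrow> 'r struct \<Rightarrow> bool" where
  "finite_big_ramsey_degrees ar B \<longleftrightarrow>
     (\<forall>A. finite_struct ar A \<and> embs ar A B \<noteq> {} \<longrightarrow> (\<exists>l. big_ramsey_le ar A B l))"

end

theory Submission
  imports Defs
begin

text \<open>
  A node of the tree below is a vertex together with its relations of all arities to the vertices
  of lower levels; reading off these relations gives a structure that omits the forbidden family,
  hence embeds into H. Conversely H is coded along suitable nodes of the tree, also inside any copy
  of the tree in itself. It therefore suffices to find a copy of the tree in which the colour of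
  finitely many nodes depends only on their type, where only finitely many types occur for n
  coded vertices.

  The copy is obtained from minimal idempotents e in the semigroup of ultrafilters on words: every
  word a has a right inverse y relative to e, that is e a y = e, and an idempotent for the
  nodes of one level lies above an idempotent for the nodes of the next level that projects back
  to it along all choices of successors. This makes the colour independent of the last growth
  phase of a configuration, and induction removes all of them.
\<close>

section \<open>Ultrafilters on words\<close>

text \<open>Two obstacles shape the proof. First, relations of all arities occur, so the number of
  patterns on k vertices may grow with k, and the letters describing a vertex over its predecessors
  cannot be bounded. Only finitely many types may result. Hence the coding is tuned to a number
  \<open>n\<close> above the size of the finite structure: patterns on at most \<open>n\<close>
  vertices are visible to the type, and everything else sits at levels where the nodes of a
  configuration neither end nor split. Second, a copy of the tree must place a prescribed letter at
  each image level. It is not drawn from the ultrafilter supplying the growth words, so idempotence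
  alone would not absorb it; minimality does, because the ultrafilters
  \<open>e \<star> x \<star> e\<close> then form a group with unit \<open>e\<close>. The order of
  choices matters too: the set of types depends only on \<open>n\<close> and a bound for the visible
  patterns, so the copy can be fixed before the levels of the coded vertices, which are then pushed
  up as far as the copy requires.\<close>

definition ultra :: "'a filter \<Rightarrow> bool" where
  "ultra F \<longleftrightarrow> F \<noteq> bot \<and> (\<forall>P. eventually P F \<or> eventually (\<lambda>x. \<not> P x) F)"

text \<open>A filter stands for the closed set of ultrafilters below it, and
  \<open>F \<le> G\<close> for inclusion. A minimal filter is thus a minimal closed set, and the
  chain condition takes the place of compactness.\<close>

lemma filter_Zorn:
  fixes A :: "'a filter set"
  assumes "F0 \<in> A"
    and chain: "\<And>C. C \<noteq> {} \<Longrightarrow> C \<subseteq> A \<Longrightarrow> (\<And>F G. F \<in> C \<Longrightarrow> G \<in> C \<Longrightarrow> F \<le> G \<or> G \<le> F) \<Longrightarrow> Inf C \<in> A"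
  shows "\<exists>M\<in>A. \<forall>G\<in>A. G \<le> M \<longrightarrow> G = M"
proof -
  have "\<exists>m\<in>A. \<forall>a\<in>A. (\<lambda>F G. G \<le> F) m a \<longrightarrow> a = m"
  proof (rule predicate_Zorn)
    show "partial_order_on A (relation_of (\<lambda>F G. G \<le> F) A)"
      by (auto simp: partial_order_on_def preorder_on_def refl_on_def trans_def antisym_def relation_of_def)
  next
    fix C assume C: "C \<in> Chains (relation_of (\<lambda>F G. G \<le> F) A)"
    show "\<exists>u\<in>A. \<forall>a\<in>C. u \<le> a"
    proof (cases "C = {}")
      case True
      then show ?thesis using assms(1) by auto
    next
      case False
      have "Inf C \<in> A"
        by (rule chain) (use C False in \<open>auto simp: Chains_def relation_of_def\<close>)
      then show ?thesis by (auto intro: Inf_lower)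
    qed
  qed
  then show ?thesis by simp
qed

lemma eventually_Inf_chain:
  fixes C :: "'a filter set"
  assumes "C \<noteq> {}" and "\<And>F G. F \<in> C \<Longrightarrow> G \<in> C \<Longrightarrow> F \<le> G \<or> G \<le> F"
  shows "eventually P (Inf C) \<longleftrightarrow> (\<exists>F\<in>C. eventually P F)"
proof (rule eventually_Inf_base[OF assms(1)])
  fix F G assume "F \<in> C" "G \<in> C"
  then show "\<exists>K\<in>C. K \<le> inf F G" using assms(2)[of F G] by (metis inf.absorb1 inf.absorb2 order_refl)
qed

lemma Inf_chain_neq_bot:
  fixes C :: "'a filter set"
  assumes "C \<noteq> {}" and "\<And>F G. F \<in> C \<Longrightarrow> G \<in> C \<Longrightarrow> F \<le> G \<or> G \<le> F" and "\<And>F. F \<in> C \<Longrightarrow> F \<noteq> bot"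
  shows "Inf C \<noteq> bot"
  using eventually_Inf_chain[OF assms(1,2), of "\<lambda>_. False"] assms(3)
  by (auto simp: trivial_limit_def)

lemma ultra_exists:
  fixes F :: "'a filter"
  assumes "F \<noteq> bot"
  shows "\<exists>U. ultra U \<and> U \<le> F"
proof -
  have "\<exists>M\<in>{G. G \<noteq> bot \<and> G \<le> F}. \<forall>G\<in>{G. G \<noteq> bot \<and> G \<le> F}. G \<le> M \<longrightarrow> G = M"
  proof (rule filter_Zorn)
    show "F \<in> {G. G \<noteq> bot \<and> G \<le> F}" using assms by simp
  next
    fix C :: "'a filter set"
    assume C: "C \<noteq> {}" "C \<subseteq> {G. G \<noteq> bot \<and> G \<le> F}" "\<And>F G. F \<in> C \<Longrightarrow> G \<in> C \<Longrightarrow> F \<le> G \<or> G \<le> F"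
    have "Inf C \<noteq> bot" by (rule Inf_chain_neq_bot) (use C in auto)
    moreover have "Inf C \<le> F" using C(1,2) by (auto intro: Inf_lower2)
    ultimately show "Inf C \<in> {G. G \<noteq> bot \<and> G \<le> F}" by simp
  qed
  then obtain M where M: "M \<noteq> bot" "M \<le> F" and min: "\<And>G. G \<noteq> bot \<Longrightarrow> G \<le> M \<Longrightarrow> G = M"
    by (metis (mono_tags, lifting) dual_order.trans mem_Collect_eq)
  have "eventually P M \<or> eventually (\<lambda>x. \<not> P x) M" for P
  proof (cases "inf M (principal {x. P x}) = bot")
    case True
    then have "eventually (\<lambda>_. False) (inf M (principal {x. P x}))" by simp
    then show ?thesis unfolding eventually_inf_principal by simp
  next
    case False
    then have "inf M (principal {x. P x}) = M" by (intro min) auto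
    then have "M \<le> principal {x. P x}" by (metis inf.cobounded2)
    then show ?thesis by (simp add: le_principal)
  qed
  then show ?thesis using M by (auto simp: ultra_def)
qed

lemma ultra_not: 
  assumes U: "ultra U"
  shows "eventually (\<lambda>x. \<not> P x) U \<longleftrightarrow> \<not> eventually P U"
proof
  assume n: "eventually (\<lambda>x. \<not> P x) U"
  show "\<not> eventually P U"
  proof
    assume "eventually P U"
    with n have "eventually (\<lambda>_. False) U" by eventually_elim simp
    with U show False by (simp add: ultra_def trivial_limit_def)
  qed
qed (use U in \<open>auto simp: ultra_def\<close>)

lemma ultra_le_eq:
  assumes "F \<noteq> bot" "ultra U" "F \<le> U" shows "F = U"
proof (rule antisym[OF assms(3)])
  show "U \<le> F"
  proof (rule filter_leI)
    fix P assume P: "eventually P F"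
    show "eventually P U"
    proof (rule ccontr)
      assume "\<not> eventually P U"
      then have "eventually (\<lambda>x. \<not> P x) F"
        using assms(2,3) by (simp add: ultra_not[symmetric] filter_leD)
      with P have "eventually (\<lambda>_. False) F" by eventually_elim simp
      with assms(1) show False by (simp add: trivial_limit_def)
    qed
  qed
qed

lemma le_filter_if_ultra_le:
  assumes "\<And>U. ultra U \<Longrightarrow> U \<le> F \<Longrightarrow> U \<le> G" shows "F \<le> G"
proof (rule filter_leI)
  fix P assume P: "eventually P G"
  show "eventually P F"
  proof (rule ccontr)
    assume "\<not> eventually P F"
    then have "inf F (principal {x. \<not> P x}) \<noteq> bot"
      unfolding trivial_limit_def eventually_inf_principal by simp
    then obtain U where U: "ultra U" "U \<le> inf F (principal {x. \<not> P x})" using ultra_exists by blast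
    then have "eventually (\<lambda>x. \<not> P x) U" by (simp add: le_principal)
    moreover have "U \<le> G" using U assms by auto
    then have "eventually P U" using P by (simp add: filter_leD)
    ultimately show False using U(1) ultra_not by blast
  qed
qed

lemma ultra_filtermap: "ultra U \<Longrightarrow> ultra (filtermap f U)"
  unfolding ultra_def by (auto simp: eventually_filtermap filtermap_bot_iff)

lemma ultra_principal: "ultra (principal {x})"
  by (auto simp: ultra_def eventually_principal principal_eq_bot_iff)

lemma eventually_finite_Ball:
  "finite A \<Longrightarrow> (\<And>a. a \<in> A \<Longrightarrow> eventually (P a) F) \<Longrightarrow> eventually (\<lambda>x. \<forall>a\<in>A. P a x) F"
  by (simp add: eventually_ball_finite)

lemma ultra_finite_colour:
  fixes c :: "'a \<Rightarrow> nat"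
  assumes "ultra U" and "\<And>x. c x < k"
  shows "\<exists>i. eventually (\<lambda>x. c x = i) U"
proof (rule ccontr)
  assume "\<not> ?thesis"
  then have "\<forall>i\<in>{..<k}. eventually (\<lambda>x. c x \<noteq> i) U" using assms(1) by (simp add: ultra_not)
  then have "eventually (\<lambda>x. \<forall>i\<in>{..<k}. c x \<noteq> i) U" by (intro eventually_finite_Ball) auto
  moreover have "(\<lambda>x. \<forall>i\<in>{..<k}. c x \<noteq> i) = (\<lambda>_. False)" using assms(2) by auto
  ultimately show False using assms(1) by (simp add: ultra_def trivial_limit_def)
qed

lemma top_filter_neq_bot: "(top :: 'a filter) \<noteq> bot"
  by (simp add: trivial_limit_def eventually_top)

section \<open>Concatenation extended to filters\<close>

definition fm :: "'a list filter \<Rightarrow> 'a list filter \<Rightarrow> 'a list filter" (infixl "\<star>" 70) where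
  "F \<star> G = Abs_filter (\<lambda>P. eventually (\<lambda>x. eventually (\<lambda>y. P (x @ y)) G) F)"

lemma eventually_fm: "eventually P (F \<star> G) \<longleftrightarrow> eventually (\<lambda>x. eventually (\<lambda>y. P (x @ y)) G) F"
  unfolding fm_def
proof (rule eventually_Abs_filter)
  show "is_filter (\<lambda>P. eventually (\<lambda>x. eventually (\<lambda>y. P (x @ y)) G) F)"
  proof
    show "\<forall>\<^sub>F x in F. \<forall>\<^sub>F y in G. True" by simp
  next
    fix P Q assume "\<forall>\<^sub>F x in F. \<forall>\<^sub>F y in G. P (x @ y)" "\<forall>\<^sub>F x in F. \<forall>\<^sub>F y in G. Q (x @ y)"
    then show "\<forall>\<^sub>F x in F. \<forall>\<^sub>F y in G. P (x @ y) \<and> Q (x @ y)"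
      by eventually_elim (rule eventually_conj)
  next
    fix P Q :: "'a list \<Rightarrow> bool"
    assume "\<forall>x. P x \<longrightarrow> Q x" "\<forall>\<^sub>F x in F. \<forall>\<^sub>F y in G. P (x @ y)"
    then show "\<forall>\<^sub>F x in F. \<forall>\<^sub>F y in G. Q (x @ y)"
      by (auto elim!: eventually_mono)
  qed
qed

lemma fm_assoc: "(F \<star> G) \<star> K = F \<star> (G \<star> K)"
  by (simp add: filter_eq_iff eventually_fm)

lemma fm_mono: "F \<le> F' \<Longrightarrow> G \<le> G' \<Longrightarrow> F \<star> G \<le> F' \<star> G'"
  unfolding le_filter_def eventually_fm by (blast intro: eventually_mono)

lemma fm_neq_bot: "F \<noteq> bot \<Longrightarrow> G \<noteq> bot \<Longrightarrow> F \<star> G \<noteq> bot"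
  unfolding trivial_limit_def eventually_fm by simp

lemma ultra_fm: assumes "ultra U" "ultra V" shows "ultra (U \<star> V)"
proof -
  have "eventually P (U \<star> V) \<or> eventually (\<lambda>x. \<not> P x) (U \<star> V)" for P
    unfolding eventually_fm using assms by (simp add: ultra_not)
  then show ?thesis using assms fm_neq_bot unfolding ultra_def by blast
qed

lemma filtermap_fm: "filtermap (map g) (F \<star> G) = filtermap (map g) F \<star> filtermap (map g) G"
  by (simp add: filter_eq_iff eventually_fm eventually_filtermap)

text \<open>The residual of right multiplication by \<open>U\<close>: as a closed set, the preimage
  of \<open>R\<close> under \<open>\<lambda>V. V \<star> U\<close>.\<close>

definition resid :: "'a list filter \<Rightarrow> 'a list filter \<Rightarrow> 'a list filter" where
  "resid U R = (INF P\<in>{P. eventually P R}. principal {x. eventually (\<lambda>y. P (x @ y)) U})"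

lemma le_resid_iff: "F \<le> resid U R \<longleftrightarrow> F \<star> U \<le> R"
  unfolding resid_def le_INF_iff le_principal le_filter_def[of _ R] eventually_fm by auto

lemma eventually_resid:
  "eventually Q (resid U R) \<longleftrightarrow> (\<exists>P. eventually P R \<and> (\<forall>x. eventually (\<lambda>y. P (x @ y)) U \<longrightarrow> Q x))"
proof -
  have "eventually Q (resid U R) \<longleftrightarrow>
    (\<exists>P\<in>{P. eventually P R}. eventually Q (principal {x. eventually (\<lambda>y. P (x @ y)) U}))"
    unfolding resid_def
  proof (rule eventually_INF_base)
    show "{P. eventually P R} \<noteq> {}" by (auto intro: exI[of _ "\<lambda>_. True"])
  next
    fix P Q assume "P \<in> {P. eventually P R}" "Q \<in> {P. eventually P R}"
    then show "\<exists>S\<in>{P. eventually P R}. principal {x. eventually (\<lambda>y. S (x @ y)) U} \<le>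
      inf (principal {x. eventually (\<lambda>y. P (x @ y)) U}) (principal {x. eventually (\<lambda>y. Q (x @ y)) U})"
      by (intro bexI[of _ "\<lambda>x. P x \<and> Q x"]) (auto simp: eventually_conj_iff)
  qed
  then show ?thesis by (auto simp: eventually_principal)
qed

text \<open>Right multiplication by \<open>U\<close> is continuous and so maps the closed set
  \<open>F\<close> onto the closed set \<open>F \<star> U\<close>. Were \<open>F\<close> disjoint
  from the preimage of \<open>R\<close>, the complement of some set of \<open>R\<close> would be
  large for \<open>F \<star> U\<close>.\<close>

lemma ultra_below_fm:
  assumes "ultra U" "ultra R" "R \<le> F \<star> U"
  shows "\<exists>V. ultra V \<and> V \<le> F \<and> V \<star> U = R"
proof -
  have "inf F (resid U R) \<noteq> bot"
  proof
    assume "inf F (resid U R) = bot"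
    then have "eventually (\<lambda>_. False) (inf F (resid U R))" by simp
    then obtain Q Q' where Q: "eventually Q F" "eventually Q' (resid U R)" "\<And>x. Q x \<Longrightarrow> Q' x \<Longrightarrow> False"
      unfolding eventually_inf by auto
    then obtain P where P: "eventually P R" "\<And>x. eventually (\<lambda>y. P (x @ y)) U \<Longrightarrow> Q' x"
      unfolding eventually_resid by blast
    have "eventually (\<lambda>x. eventually (\<lambda>y. \<not> P (x @ y)) U) F"
      using Q(1) by eventually_elim (use Q(3) P(2) assms(1) in \<open>auto simp: ultra_not\<close>)
    then have "eventually (\<lambda>x. \<not> P x) R" using assms(3) by (simp add: filter_leD eventually_fm)
    then show False using P(1) assms(2) ultra_not by blast
  qed
  then obtain V where V: "ultra V" "V \<le> inf F (resid U R)" using ultra_exists by blast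
  then have "V \<star> U \<le> R" by (simp add: le_resid_iff[symmetric])
  then have "V \<star> U = R" using ultra_le_eq assms V ultra_fm unfolding ultra_def by metis
  then show ?thesis using V by auto
qed

section \<open>Idempotents and minimal left ideals\<close>

definition subsemi :: "'a list filter \<Rightarrow> bool" where
  "subsemi F \<longleftrightarrow> F \<noteq> bot \<and> (\<forall>U V. ultra U \<longrightarrow> ultra V \<longrightarrow> U \<le> F \<longrightarrow> V \<le> F \<longrightarrow> U \<star> V \<le> F)"

text \<open>The Ellis-Numakura argument: in a minimal closed subsemigroup \<open>M\<close> with a
  point \<open>U\<close>, minimality gives \<open>M \<star> U = M\<close>. The points
  \<open>V\<close> of \<open>M\<close> with \<open>V \<star> U = U\<close> then form a nonempty
  closed subsemigroup, which must be \<open>M\<close> and so contains \<open>U\<close>.\<close>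

lemma Ellis_idempotent:
  fixes F :: "'a list filter"
  assumes "subsemi F" shows "\<exists>e. ultra e \<and> e \<le> F \<and> e \<star> e = e"
proof -
  have "\<exists>M\<in>{G. subsemi G \<and> G \<le> F}. \<forall>G\<in>{G. subsemi G \<and> G \<le> F}. G \<le> M \<longrightarrow> G = M"
  proof (rule filter_Zorn)
    show "F \<in> {G. subsemi G \<and> G \<le> F}" using assms by simp
  next
    fix C :: "'a list filter set"
    assume C: "C \<noteq> {}" "C \<subseteq> {G. subsemi G \<and> G \<le> F}" "\<And>F G. F \<in> C \<Longrightarrow> G \<in> C \<Longrightarrow> F \<le> G \<or> G \<le> F"
    have "Inf C \<noteq> bot" by (rule Inf_chain_neq_bot) (use C in \<open>auto simp: subsemi_def\<close>)
    moreover have "Inf C \<le> F" using C(1,2) by (auto intro: Inf_lower2)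
    moreover have "U \<star> V \<le> Inf C" if "ultra U" "ultra V" "U \<le> Inf C" "V \<le> Inf C" for U V
      using that C(2) unfolding le_Inf_iff subsemi_def by blast
    ultimately show "Inf C \<in> {G. subsemi G \<and> G \<le> F}" by (simp add: subsemi_def)
  qed
  then obtain M where M: "subsemi M" "M \<le> F" and min: "\<And>G. subsemi G \<Longrightarrow> G \<le> M \<Longrightarrow> G = M"
    by (metis (mono_tags, lifting) dual_order.trans mem_Collect_eq)
  obtain U where U: "ultra U" "U \<le> M" using ultra_exists M(1) unfolding subsemi_def by blast
  have below: "\<exists>V. ultra V \<and> V \<le> M \<and> V \<star> U = R" if "ultra R" "R \<le> M \<star> U" for R
    using ultra_below_fm[OF U(1) that] .
  have "M \<star> U \<le> M"
    by (rule le_filter_if_ultra_le) (use below U M(1) in \<open>unfold subsemi_def, blast\<close>)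
  moreover have "subsemi (M \<star> U)"
    unfolding subsemi_def
  proof (intro conjI allI impI)
    show "M \<star> U \<noteq> bot" using M(1) U(1) fm_neq_bot unfolding subsemi_def ultra_def by blast
  next
    fix R R' assume R: "ultra R" "ultra R'" "R \<le> M \<star> U" "R' \<le> M \<star> U"
    then obtain V' where V': "ultra V'" "V' \<le> M" "V' \<star> U = R'" using below by blast
    have "R \<le> M" using R(3) \<open>M \<star> U \<le> M\<close> by order
    then have "R \<star> V' \<le> M" using R V' M(1) unfolding subsemi_def by blast
    then show "R \<star> R' \<le> M \<star> U"
      by (metis V'(3) fm_assoc fm_mono order_refl)
  qed
  ultimately have MU: "M \<star> U = M" using min by blast
  obtain V where V: "ultra V" "V \<le> M" "V \<star> U = U" using below[of U] U MU by auto
  have "subsemi (inf M (resid U U))"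
    unfolding subsemi_def
  proof (intro conjI allI impI)
    have "V \<le> inf M (resid U U)" using V by (simp add: le_resid_iff)
    then show "inf M (resid U U) \<noteq> bot" using V(1) unfolding ultra_def by (metis le_bot)
  next
    fix R R' assume R: "ultra R" "ultra R'" "R \<le> inf M (resid U U)" "R' \<le> inf M (resid U U)"
    then have "R \<star> R' \<le> M" using M(1) unfolding subsemi_def by auto
    moreover have "R \<star> R' \<le> resid U U"
      using R unfolding le_resid_iff fm_assoc by (metis fm_mono le_inf_iff le_resid_iff order_refl order_trans)
    ultimately show "R \<star> R' \<le> inf M (resid U U)" by simp
  qed
  then have "inf M (resid U U) = M" using min by simp
  then have "U \<le> resid U U" using U(2) by (metis le_inf_iff)
  then have "U \<star> U \<le> U" by (simp add: le_resid_iff)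
  then have "U \<star> U = U" using ultra_le_eq U(1) ultra_fm unfolding ultra_def by metis
  then show ?thesis using U M(2) by auto
qed

text \<open>Minimality expressed without ideals: whatever is multiplied to \<open>e\<close> from the
  left, a further left factor leads back to \<open>e\<close>.\<close>

definition minid :: "'a list filter \<Rightarrow> bool" where
  "minid e \<longleftrightarrow> ultra e \<and> e \<star> e = e \<and> (\<forall>V. ultra V \<longrightarrow> (\<exists>X. ultra X \<and> X \<star> (V \<star> e) = e))"

definition left_ideal :: "'a list filter \<Rightarrow> bool" where
  "left_ideal F \<longleftrightarrow> F \<noteq> bot \<and> (\<forall>U V. ultra U \<longrightarrow> ultra V \<longrightarrow> V \<le> F \<longrightarrow> U \<star> V \<le> F)"

lemma left_ideal_top_fm:
  fixes U :: "'a list filter"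
  assumes "ultra U" shows "left_ideal (top \<star> U)"
  unfolding left_ideal_def
proof (intro conjI allI impI)
  show "top \<star> U \<noteq> bot" using assms by (intro fm_neq_bot) (auto simp: ultra_def top_filter_neq_bot)
next
  fix R V :: "'a list filter" assume "ultra R" "ultra V" "V \<le> top \<star> U"
  then show "R \<star> V \<le> top \<star> U"
    using ultra_below_fm[OF assms] by (metis fm_assoc fm_mono order_refl top_greatest)
qed

text \<open>An idempotent \<open>f\<close> of a minimal left ideal inside
  \<open>top \<star> p\<close> satisfies \<open>f \<star> p = f\<close>, while
  \<open>p \<star> f = f\<close> may fail. The product \<open>p \<star> f\<close> stays in the
  ideal, is again idempotent, and absorbs \<open>p\<close> on both sides.\<close>

lemma minid_below:
  fixes p :: "'a list filter"
  assumes p: "ultra p" "p \<star> p = p"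
  shows "\<exists>e. minid e \<and> p \<star> e = e \<and> e \<star> p = e"
proof -
  let ?A = "{G. left_ideal G \<and> G \<le> top \<star> p}"
  have "\<exists>M\<in>?A. \<forall>G\<in>?A. G \<le> M \<longrightarrow> G = M"
  proof (rule filter_Zorn)
    show "top \<star> p \<in> ?A" using left_ideal_top_fm p by simp
  next
    fix C :: "'a list filter set"
    assume C: "C \<noteq> {}" "C \<subseteq> ?A" "\<And>F G. F \<in> C \<Longrightarrow> G \<in> C \<Longrightarrow> F \<le> G \<or> G \<le> F"
    have "Inf C \<noteq> bot" by (rule Inf_chain_neq_bot) (use C in \<open>auto simp: left_ideal_def\<close>)
    moreover have "Inf C \<le> top \<star> p" using C(1,2) by (auto intro: Inf_lower2)
    moreover have "U \<star> V \<le> Inf C" if "ultra U" "ultra V" "V \<le> Inf C" for U V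
      using that C(2) unfolding le_Inf_iff left_ideal_def by blast
    ultimately show "Inf C \<in> ?A" by (simp add: left_ideal_def)
  qed
  then obtain M where M: "left_ideal M" "M \<le> top \<star> p"
    and min: "\<And>G. left_ideal G \<Longrightarrow> G \<le> M \<Longrightarrow> G = M"
    by (metis (mono_tags, lifting) dual_order.trans mem_Collect_eq)
  have M_eq: "top \<star> V = M" if V: "ultra V" "V \<le> M" for V
  proof (rule min[OF left_ideal_top_fm[OF V(1)]])
    show "top \<star> V \<le> M"
      by (rule le_filter_if_ultra_le)
        (use ultra_below_fm[OF V(1)] V M(1) in \<open>unfold left_ideal_def, blast\<close>)
  qed
  have "subsemi M" using M(1) unfolding left_ideal_def subsemi_def by blast
  then obtain f where f: "ultra f" "f \<le> M" "f \<star> f = f" using Ellis_idempotent by blast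
  have "f \<le> top \<star> p" using f(2) M(2) by order
  then obtain v where v: "ultra v" "v \<star> p = f" using ultra_below_fm[OF p(1) f(1)] by blast
  have fp: "f \<star> p = f" using v p by (metis fm_assoc)
  define e where "e = p \<star> f"
  have e: "ultra e" "e \<le> M"
    using p f M(1) by (auto simp: e_def ultra_fm left_ideal_def)
  have "e \<star> e = p \<star> (f \<star> p) \<star> f" by (simp add: e_def fm_assoc)
  also have "\<dots> = e" by (simp add: fp fm_assoc f(3) e_def)
  finally have ee: "e \<star> e = e" .
  have "\<exists>X. ultra X \<and> X \<star> (V \<star> e) = e" if "ultra V" for V
  proof -
    have Ve: "ultra (V \<star> e)" "V \<star> e \<le> M" using that e M(1) by (auto simp: ultra_fm left_ideal_def)
    have "e \<le> top \<star> (V \<star> e)" using M_eq[OF Ve] e(2) by simp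
    then show ?thesis using ultra_below_fm[OF Ve(1) e(1)] by blast
  qed
  then have "minid e" using e ee by (simp add: minid_def)
  moreover have "p \<star> e = e" unfolding e_def by (metis fm_assoc p(2))
  moreover have "e \<star> p = e" by (simp add: e_def fm_assoc fp)
  ultimately show ?thesis by blast
qed

lemma minid_exists: "\<exists>e :: 'a list filter. minid e"
proof -
  have "subsemi (top :: 'a list filter)" by (simp add: subsemi_def top_filter_neq_bot)
  then show ?thesis using Ellis_idempotent minid_below by metis
qed

text \<open>Nothing lies strictly below \<open>e\<close> in the order of idempotents: multiplying
  \<open>X \<star> e' = e\<close> by \<open>e'\<close> on the right gives
  \<open>e \<star> e' = e\<close>.\<close>

lemma minid_eqI:
  assumes e: "minid e" and "ultra e'" "e' \<star> e' = e'" "e' \<star> e = e'" "e \<star> e' = e'"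
  shows "e' = e"
proof -
  obtain X where "X \<star> e' = e" using e assms(2,4) unfolding minid_def by metis
  then show ?thesis using assms(3,5) by (metis fm_assoc)
qed

text \<open>In the semigroup of all \<open>e \<star> x \<star> e\<close>, minimality supplies left
  inverses, and a left inverse of a left inverse is the element itself. So this is a group, and
  \<open>y\<close> is the inverse of \<open>e \<star> a \<star> e\<close>.\<close>

lemma minid_right_inverse:
  assumes e: "minid e" and a: "ultra a"
  shows "\<exists>y. ultra y \<and> y \<star> e = y \<and> e \<star> (a \<star> y) = e"
proof -
  have ue: "ultra e" and ee: "e \<star> e = e" using e by (auto simp: minid_def)
  have ee': "e \<star> (e \<star> z) = e \<star> z" for z using ee by (metis fm_assoc)
  obtain X where X: "ultra X" "X \<star> ((e \<star> a) \<star> e) = e" using e a ue ultra_fm unfolding minid_def by metis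
  obtain X' where X': "ultra X'" "X' \<star> ((e \<star> X) \<star> e) = e" using e X(1) ue ultra_fm unfolding minid_def by metis
  define z y where "z = e \<star> (a \<star> e)" and "y = e \<star> (X \<star> e)"
  have yz: "y \<star> z = e" using X(2) by (simp add: y_def z_def fm_assoc ee' ee)
  define y' where "y' = e \<star> (X' \<star> e)"
  have y'y: "y' \<star> y = e" using X'(2) by (simp add: y_def y'_def fm_assoc ee' ee)
  have "z = y' \<star> (y \<star> z)" using y'y by (metis fm_assoc z_def ee')
  also have "\<dots> = y'" unfolding yz by (simp add: y'_def fm_assoc ee)
  finally have "z \<star> y = e" using y'y by simp
  moreover have "z \<star> y = e \<star> (a \<star> y)" by (simp add: z_def y_def fm_assoc ee')
  moreover have "y \<star> e = y" "ultra y" using X(1) ue by (simp_all add: y_def fm_assoc ee ultra_fm)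
  ultimately show ?thesis by metis
qed

section \<open>A self-similar tree and its copies\<close>

text \<open>
  A node of the tree is a list of letters. The letter Nd N d at position i of a node x is the
  relation of the vertex x to the vertices of level i: a number N together with a further node d,
  which in turn describes how this relation depends on the levels below i.
\<close>

datatype nd = Nd (pay: nat) (sub: "nd list")

text \<open>
  The subnode of a letter at position i is kept strictly shorter than i (for i > 0). In the
  inductive construction of a copy, the image of the letters of one level is therefore known
  before the image of that level is chosen.
\<close>

inductive_set T :: "nd list set" where
  TI: "(\<forall>i<length x. pay (x ! i) \<le> i \<and> length (sub (x ! i)) \<le> i - 1 \<and> sub (x ! i) \<in> T) \<Longrightarrow> x \<in> T"

definition okl :: "nat \<Rightarrow> nd \<Rightarrow> bool" where
  "okl i a \<longleftrightarrow> pay a \<le> i \<and> length (sub a) \<le> i - 1 \<and> sub a \<in> T"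

lemma T_iff: "x \<in> T \<longleftrightarrow> (\<forall>i<length x. okl i (x ! i))"
  unfolding okl_def using T.cases[of x] TI[of x] by blast

lemma T_Nil [simp]: "[] \<in> T" by (simp add: T_iff)

lemma okl_default [simp]: "okl i (Nd 0 [])" by (simp add: okl_def)

lemma T_snoc: "x @ [a] \<in> T \<longleftrightarrow> x \<in> T \<and> okl (length x) a"
  unfolding T_iff by (auto simp: nth_append less_Suc_eq)

lemma T_take: "x \<in> T \<Longrightarrow> take i x \<in> T"
  unfolding T_iff by auto

lemma T_sub: "x \<in> T \<Longrightarrow> i < length x \<Longrightarrow> sub (x ! i) \<in> T"
  using T_iff[of x] unfolding okl_def by blast

lemma T_sub_length: "x \<in> T \<Longrightarrow> i < length x \<Longrightarrow> length (sub (x ! i)) \<le> i - 1"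
  using T_iff[of x] unfolding okl_def by blast

lemma T_last: "x \<in> T \<Longrightarrow> length x = Suc l \<Longrightarrow> okl l (last x)"
  using T_iff[of x] by (metis diff_Suc_1 last_conv_nth length_0_conv lessI nat.distinct(1))

section \<open>Finite levels and repair of words\<close>

definition Tl :: "nat \<Rightarrow> nd list set" where "Tl l = {x \<in> T. length x = l}"

text \<open>The bound \<open>pay a \<le> i\<close> in \<open>okl\<close> serves this: finitely many
  events and sections per level can share one set that is large for an ultrafilter.\<close>

lemma finite_Tl: "finite (Tl l)"
proof (induction l rule: less_induct)
  case (less l)
  show ?case
  proof (cases l)
    case 0
    have "Tl 0 = {[]}" by (auto simp: Tl_def)
    then show ?thesis using 0 by simp
  next
    case (Suc k)
    have "Tl l \<subseteq> (\<lambda>(u, N, d). u @ [Nd N d]) ` (Tl k \<times> {..k} \<times> (\<Union>j\<in>{..k - 1}. Tl j))"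
    proof
      fix x assume x: "x \<in> Tl l"
      then obtain u a where xu: "x = u @ [a]" using Suc by (cases x rule: rev_cases) (auto simp: Tl_def)
      then have "u \<in> Tl k" "okl k a" using x Suc by (auto simp: Tl_def T_snoc)
      then have "(u, pay a, sub a) \<in> Tl k \<times> {..k} \<times> (\<Union>j\<in>{..k - 1}. Tl j)"
        by (auto simp: okl_def Tl_def)
      then show "x \<in> (\<lambda>(u, N, d). u @ [Nd N d]) ` (Tl k \<times> {..k} \<times> (\<Union>j\<in>{..k - 1}. Tl j))"
        using xu by (force intro!: image_eqI[where x = "(u, pay a, sub a)"])
    qed
    moreover have "finite (Tl k \<times> {..k} \<times> (\<Union>j\<in>{..k - 1}. Tl j))"
      using less Suc by auto
    ultimately show ?thesis by (rule finite_surj[rotated])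
  qed
qed

text \<open>A retraction of arbitrary words onto the tree. It lets growth words range over a free
  semigroup whose letters need not suit the level at which they land.\<close>

definition eta :: "nd list \<Rightarrow> nd list" where
  "eta x = map (\<lambda>i. if okl i (x ! i) then x ! i else Nd 0 []) [0..<length x]"

lemma length_eta [simp]: "length (eta x) = length x" by (simp add: eta_def)

lemma nth_eta: "i < length x \<Longrightarrow> eta x ! i = (if okl i (x ! i) then x ! i else Nd 0 [])"
  by (simp add: eta_def)

lemma eta_in_T [simp]: "eta x \<in> T"
  by (auto simp: T_iff nth_eta)

lemma eta_id: "x \<in> T \<Longrightarrow> eta x = x"
  by (auto simp: T_iff nth_eta intro: nth_equalityI)

lemma eta_eta_append: "eta (eta x @ y) = eta (x @ y)"
  by (rule nth_equalityI) (auto simp: nth_eta nth_append)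

lemma take_eta_append: "take (length x) (eta (x @ y)) = eta x"
  by (rule nth_equalityI) (auto simp: nth_eta nth_append)

text \<open>Strictly between positions \<open>m i\<close> and \<open>m (Suc i)\<close> the image is
  free, but it depends only on the first \<open>Suc i\<close> letters of \<open>x\<close>.
  \<open>m 0 = 0\<close> sends the root to the root, where every type starts.\<close>

definition copy :: "(nat \<Rightarrow> nat) \<Rightarrow> (nd list \<Rightarrow> nd list) \<Rightarrow> bool" where
  "copy m \<phi> \<longleftrightarrow> strict_mono m \<and> m 0 = 0 \<and>
     (\<forall>x\<in>T. \<phi> x \<in> T \<and> length (\<phi> x) = m (length x) \<and>
        (\<forall>i<length x. take (m i) (\<phi> x) = \<phi> (take i x) \<and> \<phi> x ! m i = Nd (pay (x ! i)) (\<phi> (sub (x ! i)))))"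

lemma
  assumes "copy m \<phi>"
  shows copy_strict_mono: "strict_mono m"
    and copy_0: "m 0 = 0"
    and copy_in_T: "x \<in> T \<Longrightarrow> \<phi> x \<in> T"
    and copy_length: "x \<in> T \<Longrightarrow> length (\<phi> x) = m (length x)"
    and copy_take: "x \<in> T \<Longrightarrow> i < length x \<Longrightarrow> take (m i) (\<phi> x) = \<phi> (take i x)"
    and copy_nth: "x \<in> T \<Longrightarrow> i < length x \<Longrightarrow> \<phi> x ! m i = Nd (pay (x ! i)) (\<phi> (sub (x ! i)))"
  using assms by (auto simp: copy_def)

lemma copy_id: "copy (\<lambda>i. i) (\<lambda>x. x)"
  by (auto simp: copy_def strict_mono_def)

lemma copy_comp:
  assumes c1: "copy m \<phi>" and c2: "copy m' \<phi>'" shows "copy (m \<circ> m') (\<phi> \<circ> \<phi>')"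
  unfolding copy_def
proof (intro conjI ballI allI impI)
  show "strict_mono (m \<circ> m')" using c1 c2 by (auto simp: copy_def strict_mono_def)
  show "(m \<circ> m') 0 = 0" using c1 c2 by (simp add: copy_def)
next
  fix x assume x: "x \<in> T"
  have x': "\<phi>' x \<in> T" and len: "length (\<phi>' x) = m' (length x)"
    using copy_in_T[OF c2 x] copy_length[OF c2 x] by auto
  show "(\<phi> \<circ> \<phi>') x \<in> T" "length ((\<phi> \<circ> \<phi>') x) = (m \<circ> m') (length x)"
    using copy_in_T[OF c1 x'] copy_length[OF c1 x'] len by auto
  fix i assume i: "i < length x"
  then have i': "m' i < length (\<phi>' x)" using len copy_strict_mono[OF c2] by (simp add: strict_mono_less)
  show "take ((m \<circ> m') i) ((\<phi> \<circ> \<phi>') x) = (\<phi> \<circ> \<phi>') (take i x)"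
    using copy_take[OF c1 x' i'] copy_take[OF c2 x i] by simp
  show "(\<phi> \<circ> \<phi>') x ! (m \<circ> m') i = Nd (pay (x ! i)) ((\<phi> \<circ> \<phi>') (sub (x ! i)))"
    using copy_nth[OF c1 x' i'] copy_nth[OF c2 x i] by simp
qed

lemma copy_inj:
  assumes c: "copy m \<phi>" shows "inj_on \<phi> T"
proof -
  have "\<forall>x y. length x = l \<longrightarrow> x \<in> T \<longrightarrow> y \<in> T \<longrightarrow> \<phi> x = \<phi> y \<longrightarrow> x = y" for l
  proof (induction l rule: less_induct)
    case (less l)
    show ?case
    proof (intro allI impI)
      fix x y assume xy: "length x = l" "x \<in> T" "y \<in> T" "\<phi> x = \<phi> y"
      have len: "length x = length y"
        using copy_length[OF c] xy copy_strict_mono[OF c] by (metis strict_mono_eq)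
      show "x = y"
      proof (rule nth_equalityI[OF len])
        fix i assume i: "i < length x"
        have "pay (x ! i) = pay (y ! i)" and s: "\<phi> (sub (x ! i)) = \<phi> (sub (y ! i))"
          using copy_nth[OF c xy(2) i] copy_nth[OF c xy(3)] i len xy(4) by auto
        moreover have "length (sub (x ! i)) < l" using T_sub_length[OF xy(2) i] i xy(1) by simp
        then have "sub (x ! i) = sub (y ! i)"
          using less s T_sub xy i len by metis
        ultimately show "x ! i = y ! i" by (simp add: nd.expand)
      qed
    qed
  qed
  then show ?thesis by (auto simp: inj_on_def)
qed

section \<open>Eliminating the last growth phase\<close>

definition lt :: "(nd list \<Rightarrow> nd list) \<Rightarrow> nd list \<Rightarrow> nd" where
  "lt f z = Nd (pay (last z)) (f (sub (last z)))"

text \<open>The image planned for \<open>z\<close> once the growth word \<open>w\<close> of its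
  level is chosen: first the letter forced by the definition of a copy, then the values at
  \<open>z\<close> of the functions in \<open>w\<close>.\<close>

definition ext :: "(nd list \<Rightarrow> nd list) \<Rightarrow> (nd list \<Rightarrow> nd) list \<Rightarrow> nd list \<Rightarrow> nd list" where
  "ext f w z = eta (f (butlast z) @ lt f z # map (\<lambda>F. F z) w)"

text \<open>
  Words over the alphabet of all functions from nodes to letters describe the simultaneous growth
  of all nodes of one level. A section picks one successor for every node of a level.
\<close>

definition Sec :: "nat \<Rightarrow> (nd list \<Rightarrow> nd list) set" where
  "Sec l = {\<sigma>. (\<forall>u\<in>Tl l. \<sigma> u \<in> Tl (Suc l) \<and> butlast (\<sigma> u) = u) \<and> (\<forall>u. u \<notin> Tl l \<longrightarrow> \<sigma> u = u @ [Nd 0 []])}"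

lemma finite_Sec: "finite (Sec l)"
proof (rule finite_surj)
  show "finite (PiE (Tl l) (\<lambda>_. Tl (Suc l)))" by (simp add: finite_PiE finite_Tl)
  show "Sec l \<subseteq> (\<lambda>g u. if u \<in> Tl l then g u else u @ [Nd 0 []]) ` (PiE (Tl l) (\<lambda>_. Tl (Suc l)))"
  proof
    fix \<sigma> assume s: "\<sigma> \<in> Sec l"
    show "\<sigma> \<in> (\<lambda>g u. if u \<in> Tl l then g u else u @ [Nd 0 []]) ` (PiE (Tl l) (\<lambda>_. Tl (Suc l)))"
      by (rule image_eqI[of _ _ "restrict \<sigma> (Tl l)"]) (use s in \<open>auto simp: Sec_def\<close>)
  qed
qed

text \<open>The default value outside \<open>Tl l\<close> makes a section invert
  \<open>butlast\<close> on all lists, as \<open>coherent_minids\<close> demands, while leaving only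
  finitely many sections.\<close>

lemma Sec_butlast: "\<sigma> \<in> Sec l \<Longrightarrow> butlast (\<sigma> u) = u"
  by (cases "u \<in> Tl l") (auto simp: Sec_def)

text \<open>Let \<open>q\<close> be \<open>p\<close> pulled back along \<open>butlast\<close>, and
  \<open>e\<close> a minimal idempotent below \<open>q\<close>. Since a section inverts
  \<open>butlast\<close>, projecting along it sends \<open>q\<close> to \<open>p\<close> and
  \<open>e\<close> to an idempotent below \<open>p\<close>, which is \<open>p\<close> by minimality.
  So one \<open>e\<close> serves all sections.\<close>

lemma coherent_minids:
  "\<exists>e :: nat \<Rightarrow> (nd list \<Rightarrow> nd) list filter. \<forall>l. minid (e l) \<and>
     (\<forall>\<sigma>. (\<forall>u. butlast (\<sigma> u) = u) \<longrightarrow> filtermap (map (\<lambda>F. F \<circ> \<sigma>)) (e (Suc l)) = e l)"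
proof -
  have "\<exists>e :: nat \<Rightarrow> (nd list \<Rightarrow> nd) list filter. \<forall>l. minid (e l) \<and>
     (\<forall>\<sigma>. (\<forall>u. butlast (\<sigma> u) = u) \<longrightarrow> filtermap (map (\<lambda>F. F \<circ> \<sigma>)) (e (Suc l)) = e l)"
  proof (rule dependent_nat_choice)
    show "\<exists>x :: (nd list \<Rightarrow> nd) list filter. minid x" by (rule minid_exists)
  next
    fix p :: "(nd list \<Rightarrow> nd) list filter" and l :: nat
    assume p: "minid p"
    define q where "q = filtermap (map (\<lambda>F :: nd list \<Rightarrow> nd. F \<circ> butlast)) p"
    have "ultra q" "q \<star> q = q"
      using p by (auto simp: q_def ultra_filtermap minid_def filtermap_fm[symmetric])
    then obtain e where e: "minid e" "q \<star> e = e" "e \<star> q = e" using minid_below by blast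
    have "filtermap (map (\<lambda>F. F \<circ> \<sigma>)) e = p" if \<sigma>: "\<forall>u. butlast (\<sigma> u) = u" for \<sigma> :: "nd list \<Rightarrow> nd list"
    proof (rule minid_eqI[OF p])
      let ?h = "filtermap (map (\<lambda>F :: nd list \<Rightarrow> nd. F \<circ> \<sigma>))"
      have "(\<lambda>x. map (\<lambda>F :: nd list \<Rightarrow> nd. F \<circ> \<sigma>) (map (\<lambda>F. F \<circ> butlast) x)) = (\<lambda>x. x)"
        using \<sigma> by (auto simp: fun_eq_iff o_def)
      then have hq: "?h q = p" by (simp add: q_def filtermap_filtermap)
      show "ultra (?h e)" using e by (simp add: ultra_filtermap minid_def)
      show "?h e \<star> ?h e = ?h e" using e(1) by (simp add: filtermap_fm[symmetric] minid_def)
      show "?h e \<star> p = ?h e" unfolding hq[symmetric] by (simp add: filtermap_fm[symmetric] e)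
      show "p \<star> ?h e = ?h e" unfolding hq[symmetric] by (simp add: filtermap_fm[symmetric] e)
    qed
    then show "\<exists>y. minid y \<and> (\<forall>\<sigma>. (\<forall>u. butlast (\<sigma> u) = u) \<longrightarrow> filtermap (map (\<lambda>F. F \<circ> \<sigma>)) y = p)"
      using e(1) by blast
  qed
  then show ?thesis .
qed

text \<open>The tests for stage \<open>l\<close>: \<open>ds\<close> are nodes whose images are
  settled by then, \<open>ys\<close> nodes right above an event at level \<open>l\<close>. As
  \<open>ys\<close> is distinct, any growth of its members extends to a section.\<close>

definition events :: "nat \<Rightarrow> nat \<Rightarrow> (nd list list \<times> nd list list) set" where
  "events P l = {(ds, ys). length ds \<le> P \<and> length ys \<le> P \<and> (\<forall>d\<in>set ds. d \<in> T \<and> length d \<le> l) \<and>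
     set ys \<subseteq> Tl (Suc l) \<and> distinct ys}"

lemma finite_events: "finite (events P l)"
proof (rule finite_subset)
  show "events P l \<subseteq> {ds. set ds \<subseteq> (\<Union>j\<in>{..l}. Tl j) \<and> length ds \<le> P} \<times> {ys. set ys \<subseteq> Tl (Suc l) \<and> length ys \<le> P}"
    by (auto simp: events_def Tl_def)
  show "finite ({ds. set ds \<subseteq> (\<Union>j\<in>{..l}. Tl j) \<and> length ds \<le> P} \<times> {ys. set ys \<subseteq> Tl (Suc l) \<and> length ys \<le> P})"
    by (intro finite_cartesian_product finite_lists_length_le) (auto simp: finite_Tl)
qed

lemma stage_colour:
  fixes \<chi> :: "nd list list \<Rightarrow> nd list list \<Rightarrow> nat"
  assumes s: "ultra s" and k: "\<And>ds zs. \<chi> ds zs < k"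
  shows "\<exists>B. eventually (\<lambda>w. w \<in> B) s \<and>
     (\<forall>(ds, ys)\<in>events P l. \<exists>c. \<forall>w\<in>B. \<chi> (map f ds) (map (ext f w) ys) = c)"
proof -
  have "\<exists>c. eventually (\<lambda>w. \<chi> (map f ds) (map (ext f w) ys) = c) s" for ds ys
    by (rule ultra_finite_colour[OF s k])
  then obtain c where c: "\<And>ds ys. eventually (\<lambda>w. \<chi> (map f ds) (map (ext f w) ys) = c ds ys) s" by metis
  define B where "B = {w. \<forall>(ds, ys)\<in>events P l. \<chi> (map f ds) (map (ext f w) ys) = c ds ys}"
  have "eventually (\<lambda>w. \<forall>p\<in>events P l. case p of (ds, ys) \<Rightarrow> \<chi> (map f ds) (map (ext f w) ys) = c ds ys) s"
    by (rule eventually_finite_Ball[OF finite_events]) (use c in auto)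
  then have "eventually (\<lambda>w. w \<in> B) s" by (simp add: B_def)
  moreover have "\<forall>(ds, ys)\<in>events P l. \<exists>c. \<forall>w\<in>B. \<chi> (map f ds) (map (ext f w) ys) = c"
    by (auto simp: B_def)
  ultimately show ?thesis by blast
qed

text \<open>
  At stage l of the construction a word is chosen from a set B that is large for an
  ultrafilter s with s \<star> e l = s. If a is the word of letters leading to the next level, the
  next ultrafilter s' is a right inverse of a relative to e (Suc l). Coherence of the
  idempotents then gives s = s \<star> a \<star> s', with a and s' pulled back along any section, so membership in B persists
  along every choice of successors.
\<close>

definition stage_step where
  "stage_step l w f B f' B' \<longleftrightarrow> w \<in> B \<and> f' = (\<lambda>z. if length z = Suc l then ext f w z else f z) \<and>
     (\<forall>w'\<in>B'. \<forall>\<sigma>\<in>Sec (Suc l). w @ (lt f \<circ> \<sigma>) # map (\<lambda>F. F \<circ> \<sigma>) w' \<in> B)"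

lemma stage_sequence:
  fixes \<chi> :: "nd list list \<Rightarrow> nd list list \<Rightarrow> nat"
  assumes k: "\<And>ds zs. \<chi> ds zs < k"
  shows "\<exists>F B. F 0 = (\<lambda>_. []) \<and>
    (\<forall>l. (\<forall>(ds, ys)\<in>events P l. \<exists>c. \<forall>w\<in>B l. \<chi> (map (F l) ds) (map (ext (F l) w) ys) = c) \<and>
         (\<exists>w. stage_step l w (F l) (B l) (F (Suc l)) (B (Suc l))))"
proof -
  obtain e :: "nat \<Rightarrow> (nd list \<Rightarrow> nd) list filter" where e: "\<And>l. minid (e l)"
    and coh: "\<And>l \<sigma>. (\<And>u. butlast (\<sigma> u) = u) \<Longrightarrow> filtermap (map (\<lambda>F. F \<circ> \<sigma>)) (e (Suc l)) = e l"
    using coherent_minids by blast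
  define good where "good l x \<longleftrightarrow> (case x of (f, B, s) \<Rightarrow> ultra s \<and> s \<star> e l = s \<and> eventually (\<lambda>w. w \<in> B) s \<and>
      (l = 0 \<longrightarrow> f = (\<lambda>_. [])) \<and>
      (\<forall>(ds, ys)\<in>events P l. \<exists>c. \<forall>w\<in>B. \<chi> (map f ds) (map (ext f w) ys) = c))" for l x
  define step where "step l x x' \<longleftrightarrow> (case x of (f, B, s) \<Rightarrow> case x' of (f', B', s') \<Rightarrow>
      \<exists>w. stage_step l w f B f' B')" for l and x x' :: "(nd list \<Rightarrow> nd list) \<times> (nd list \<Rightarrow> nd) list set \<times> (nd list \<Rightarrow> nd) list filter"
  have "\<exists>X. \<forall>l. good l (X l) \<and> step l (X l) (X (Suc l))"
  proof (rule dependent_nat_choice)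
    have "ultra (e 0)" "e 0 \<star> e 0 = e 0" using e[of 0] by (auto simp: minid_def)
    with stage_colour[where \<chi> = \<chi>, OF this(1) k, where P = P and l = 0 and f = "\<lambda>_. []"] show "\<exists>x. good 0 x"
      unfolding good_def by auto
  next
    fix x l assume x: "good l x"
    obtain f B s where xs: "x = (f, B, s)" by (cases x)
    have s: "ultra s" "s \<star> e l = s" "eventually (\<lambda>w. w \<in> B) s" using x by (auto simp: good_def xs)
    define a where "a = principal {[lt f]}"
    obtain s' where s': "ultra s'" "s' \<star> e (Suc l) = s'" "e (Suc l) \<star> (a \<star> s') = e (Suc l)"
      using minid_right_inverse[OF e[of "Suc l"], of a] by (auto simp: a_def ultra_principal)
    have "eventually (\<lambda>w. eventually (\<lambda>w'. w @ (lt f \<circ> \<sigma>) # map (\<lambda>F. F \<circ> \<sigma>) w' \<in> B) s') s"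
      if \<sigma>: "\<sigma> \<in> Sec (Suc l)" for \<sigma>
    proof -
      let ?h = "filtermap (map (\<lambda>F :: nd list \<Rightarrow> nd. F \<circ> \<sigma>))"
      have he: "?h (e (Suc l)) = e l" by (rule coh) (rule Sec_butlast[OF \<sigma>])
      have ha: "?h a = principal {[lt f \<circ> \<sigma>]}" by (simp add: a_def)
      have "e l \<star> (?h a \<star> ?h s') = e l"
        using arg_cong[OF s'(3), of ?h] by (simp add: filtermap_fm he)
      then have "s \<star> (?h a \<star> ?h s') = s" using s(2) by (metis fm_assoc)
      then have "eventually (\<lambda>w. w \<in> B) (s \<star> (?h a \<star> ?h s'))" using s(3) by simp
      then show ?thesis unfolding eventually_fm ha by (simp add: eventually_principal eventually_filtermap)
    qed
    then have "eventually (\<lambda>w. \<forall>\<sigma>\<in>Sec (Suc l). eventually (\<lambda>w'. w @ (lt f \<circ> \<sigma>) # map (\<lambda>F. F \<circ> \<sigma>) w' \<in> B) s') s"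
      by (intro eventually_finite_Ball finite_Sec)
    with s(3) have "eventually (\<lambda>w. w \<in> B \<and> (\<forall>\<sigma>\<in>Sec (Suc l). eventually (\<lambda>w'. w @ (lt f \<circ> \<sigma>) # map (\<lambda>F. F \<circ> \<sigma>) w' \<in> B) s')) s"
      by (rule eventually_conj)
    moreover have "s \<noteq> bot" using s(1) by (simp add: ultra_def)
    ultimately have "\<exists>w. w \<in> B \<and> (\<forall>\<sigma>\<in>Sec (Suc l). eventually (\<lambda>w'. w @ (lt f \<circ> \<sigma>) # map (\<lambda>F. F \<circ> \<sigma>) w' \<in> B) s')"
      by (rule eventually_happens'[rotated])
    then obtain w where w: "w \<in> B" and
      wS: "\<And>\<sigma>. \<sigma> \<in> Sec (Suc l) \<Longrightarrow> eventually (\<lambda>w'. w @ (lt f \<circ> \<sigma>) # map (\<lambda>F. F \<circ> \<sigma>) w' \<in> B) s'"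
      by blast
    define f' where "f' = (\<lambda>z. if length z = Suc l then ext f w z else f z)"
    obtain B1 where B1: "eventually (\<lambda>w. w \<in> B1) s'"
      "\<forall>(ds, ys)\<in>events P (Suc l). \<exists>c. \<forall>w\<in>B1. \<chi> (map f' ds) (map (ext f' w) ys) = c"
      using stage_colour[where \<chi> = \<chi>, OF s'(1) k, where P = P and l = "Suc l" and f = f'] by blast
    define B' where "B' = {w' \<in> B1. \<forall>\<sigma>\<in>Sec (Suc l). w @ (lt f \<circ> \<sigma>) # map (\<lambda>F. F \<circ> \<sigma>) w' \<in> B}"
    have "eventually (\<lambda>w'. \<forall>\<sigma>\<in>Sec (Suc l). w @ (lt f \<circ> \<sigma>) # map (\<lambda>F. F \<circ> \<sigma>) w' \<in> B) s'"
      by (intro eventually_finite_Ball finite_Sec wS)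
    with B1(1) have "eventually (\<lambda>w. w \<in> B') s'" unfolding B'_def by eventually_elim simp
    moreover have "\<forall>(ds, ys)\<in>events P (Suc l). \<exists>c. \<forall>w\<in>B'. \<chi> (map f' ds) (map (ext f' w) ys) = c"
      using B1(2) by (fastforce simp: B'_def)
    ultimately have "good (Suc l) (f', B', s')" using s' by (auto simp: good_def)
    moreover have "step l x (f', B', s')"
      unfolding step_def xs stage_step_def using w by (auto simp: B'_def f'_def intro!: exI[of _ w])
    ultimately show "\<exists>y. good (Suc l) y \<and> step l x y" by blast
  qed
  then obtain X where X: "\<And>l. good l (X l)" "\<And>l. step l (X l) (X (Suc l))" by blast
  show ?thesis
    by (rule exI[of _ "\<lambda>l. fst (X l)"], rule exI[of _ "\<lambda>l. fst (snd (X l))"])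
      (use X in \<open>simp add: good_def step_def case_prod_unfold\<close>)
qed

text \<open>To compare the growth \<open>zs\<close> with others, its top level is removed and the
  lost growth moved into the word. By persistence along a section the longer word lies in the set of
  the earlier stage, and at stage \<open>l\<close> the colour is constant on that set.\<close>

lemma one_step:
  fixes \<chi> :: "nd list list \<Rightarrow> nd list list \<Rightarrow> nat"
  assumes k: "\<And>ds zs. \<chi> ds zs < k"
  shows "\<exists>m \<phi>. copy m \<phi> \<and> (\<forall>l. \<forall>(ds, ys)\<in>events P l. \<exists>c. \<forall>L zs. L > l \<longrightarrow>
     list_all2 (\<lambda>y z. z \<in> Tl L \<and> take (Suc l) z = y) ys zs \<longrightarrow> \<chi> (map \<phi> ds) (map \<phi> zs) = c)"
proof -
  let ?C = "\<lambda>F B l. \<forall>(ds, ys)\<in>events P l. \<exists>c. \<forall>w\<in>B l. \<chi> (map (F l) ds) (map (ext (F l) w) ys) = c"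
  obtain F B where F0: "F 0 = (\<lambda>_. [])"
    and FB: "\<forall>l. ?C F B l \<and> (\<exists>w. stage_step l w (F l) (B l) (F (Suc l)) (B (Suc l)))"
    using stage_sequence[where \<chi> = \<chi> and P = P, OF k] by (elim exE conjE) (rule that)
  have col: "?C F B l" for l by (rule conjunct1[OF FB[rule_format]])
  have "\<forall>l. \<exists>w. stage_step l w (F l) (B l) (F (Suc l)) (B (Suc l))" by (rule allI) (rule conjunct2[OF FB[rule_format]])
  then obtain w where step: "\<And>l. stage_step l (w l) (F l) (B l) (F (Suc l)) (B (Suc l))" by metis
  have wB: "w l \<in> B l" and FS: "F (Suc l) = (\<lambda>z. if length z = Suc l then ext (F l) (w l) z else F l z)"
    and Bsec: "\<And>w' \<sigma>. w' \<in> B (Suc l) \<Longrightarrow> \<sigma> \<in> Sec (Suc l) \<Longrightarrow> w l @ (lt (F l) \<circ> \<sigma>) # map (\<lambda>F. F \<circ> \<sigma>) w' \<in> B l"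
    for l using step[of l] unfolding stage_step_def by blast+
  define \<phi> where "\<phi> x = F (length x) x" for x
  have F_stable: "F l x = \<phi> x" if "length x \<le> l" for l x
    using that
  proof (induction l)
    case 0 then show ?case by (simp add: \<phi>_def)
  next
    case (Suc l) then show ?case by (cases "length x = Suc l") (auto simp: FS \<phi>_def)
  qed
  \<comment> \<open>The last letter of \<open>z\<close> is at position \<open>j - 1\<close>, so its
    subnode has length at most \<open>j - 2\<close>, hence at most \<open>l\<close>: stage
    \<open>l\<close> settles the forced letters of nodes up to two levels higher.\<close>
  have lt_F: "lt (F l) z = lt \<phi> z" if "z \<in> Tl j" "0 < j" "j \<le> Suc (Suc l)" for l z j
  proof -
    have "okl (j - 1) (last z)" using that T_last[of z "j - 1"] by (auto simp: Tl_def)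
    then have "length (sub (last z)) \<le> l" using that by (auto simp: okl_def)
    then show ?thesis by (simp add: lt_def F_stable)
  qed
  have ext_F: "ext (F l) v z = ext \<phi> v z" if "z \<in> Tl (Suc l)" for l v z
    unfolding ext_def using that lt_F[OF that, of l] by (simp add: F_stable Tl_def)
  have \<phi>_Suc: "\<phi> z = ext \<phi> (w l) z" if "z \<in> Tl (Suc l)" for l z
    using that ext_F[OF that, of "w l"] by (simp add: \<phi>_def FS Tl_def)
  have \<phi>_Nil: "\<phi> [] = []" by (simp add: \<phi>_def F0)

  define m where "m = rec_nat 0 (\<lambda>l r. Suc (r + length (w l)))"
  have m0: "m 0 = 0" and mS: "\<And>l. m (Suc l) = Suc (m l + length (w l))" by (auto simp: m_def)
  have sm: "strict_mono m" by (simp add: strict_mono_Suc_iff mS)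
  have T_len: "\<phi> x \<in> T \<and> length (\<phi> x) = m (length x)" if "x \<in> T" for x
    using that
  proof (induction x rule: rev_induct)
    case Nil then show ?case by (simp add: \<phi>_Nil m0)
  next
    case (snoc a x)
    then have "\<phi> (x @ [a]) = ext \<phi> (w (length x)) (x @ [a])" by (intro \<phi>_Suc) (simp add: Tl_def)
    then show ?case using snoc by (simp add: ext_def T_snoc mS)
  qed
  have snoc_eq: "take (m (length x)) (\<phi> (x @ [a])) = \<phi> x \<and> \<phi> (x @ [a]) ! m (length x) = Nd (pay a) (\<phi> (sub a))"
    if xa: "x @ [a] \<in> T" for x a
  proof -
    have x: "x \<in> T" and a: "okl (length x) a" using xa by (auto simp: T_snoc)
    have eq: "\<phi> (x @ [a]) = eta (\<phi> x @ (Nd (pay a) (\<phi> (sub a)) # map (\<lambda>F. F (x @ [a])) (w (length x))))"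
      using \<phi>_Suc[of "x @ [a]" "length x"] xa by (simp add: Tl_def ext_def lt_def)
    have sa: "\<phi> (sub a) \<in> T" "length (\<phi> (sub a)) = m (length (sub a))"
      using a T_len[of "sub a"] by (auto simp: okl_def)
    have "m (length (sub a)) \<le> m (length x) - 1"
    proof (cases "length x = 0")
      case True then show ?thesis using a m0 by (simp add: okl_def)
    next
      case False
      then have "length (sub a) < length x" using a by (cases x) (auto simp: okl_def)
      then have "m (length (sub a)) < m (length x)" using sm by (simp add: strict_mono_less)
      then show ?thesis by simp
    qed
    moreover have "length x \<le> m (length x)" using sm by (rule strict_mono_imp_increasing)
    ultimately have "okl (m (length x)) (Nd (pay a) (\<phi> (sub a)))" using a sa by (auto simp: okl_def)
    then have "\<phi> (x @ [a]) ! m (length x) = Nd (pay a) (\<phi> (sub a))"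
      unfolding eq using T_len[OF x] by (simp add: nth_eta nth_append)
    moreover have "take (m (length x)) (\<phi> (x @ [a])) = \<phi> x"
      unfolding eq using T_len[OF x] take_eta_append[of "\<phi> x"] by (simp add: eta_id)
    ultimately show ?thesis by simp
  qed
  have prefix: "take (m i) (\<phi> x) = \<phi> (take i x) \<and> \<phi> x ! m i = Nd (pay (x ! i)) (\<phi> (sub (x ! i)))"
    if "x \<in> T" "i < length x" for x i
    using that
  proof (induction x rule: rev_induct)
    case Nil then show ?case by simp
  next
    case (snoc a x)
    show ?case
    proof (cases "i = length x")
      case True then show ?thesis using \<open>x @ [a] \<in> T\<close> snoc_eq by simp
    next
      case False
      then have i: "i < length x" using snoc by simp
      have x: "x \<in> T" using snoc by (simp add: T_snoc)
      have mi: "m i < m (length x)" using i sm by (simp add: strict_mono_less)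
      have tk: "take (m (length x)) (\<phi> (x @ [a])) = \<phi> x" using snoc.prems(1) snoc_eq by blast
      have "take (m i) (\<phi> (x @ [a])) = take (m i) (\<phi> x)" "\<phi> (x @ [a]) ! m i = \<phi> x ! m i"
        using mi by (simp_all add: tk[symmetric])
      then show ?thesis using snoc.IH[OF x i] i by (simp add: nth_append)
    qed
  qed
  have "copy m \<phi>" unfolding copy_def using sm m0 T_len prefix by blast

  moreover have "\<exists>c. \<forall>L zs. L > l \<longrightarrow> list_all2 (\<lambda>y z. z \<in> Tl L \<and> take (Suc l) z = y) ys zs \<longrightarrow> \<chi> (map \<phi> ds) (map \<phi> zs) = c"
    if ev: "(ds, ys) \<in> events P l" for l ds ys
  proof -
    have dsl: "\<forall>d\<in>set ds. length d \<le> l" and ysl: "set ys \<subseteq> Tl (Suc l)" "distinct ys" using ev by (auto simp: events_def)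
    obtain c where c: "\<And>v. v \<in> B l \<Longrightarrow> \<chi> (map (F l) ds) (map (ext (F l) v) ys) = c" using col[of l] ev by blast
    have c': "\<chi> (map \<phi> ds) (map (ext \<phi> v) ys) = c" if "v \<in> B l" for v
    proof -
      have "map (F l) ds = map \<phi> ds" using dsl by (simp add: F_stable)
      moreover have "map (ext (F l) v) ys = map (ext \<phi> v) ys" using ysl by (auto simp: ext_F subset_iff)
      ultimately show ?thesis using c[OF that] by metis
    qed
    have main: "\<chi> (map \<phi> ds) (map (ext \<phi> v) zs) = c"
      if "list_all2 (\<lambda>y z. z \<in> Tl (Suc l + j) \<and> take (Suc l) z = y) ys zs" "v \<in> B (l + j)" for j zs v
      using that
    proof (induction j arbitrary: zs v)
      case 0
      have "zs = ys" using 0(1) by (auto simp: list_all2_conv_all_nth Tl_def intro!: nth_equalityI)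
      then show ?case using c' 0 by simp
    next
      case (Suc j)
      have len: "length zs = length ys" and
        zs: "\<And>i. i < length ys \<Longrightarrow> zs ! i \<in> Tl (Suc (Suc (l + j))) \<and> take (Suc l) (zs ! i) = ys ! i"
        using Suc.prems(1) by (auto simp: list_all2_conv_all_nth)
      have bl: "butlast (zs ! i) \<in> Tl (Suc (l + j))" "take (Suc l) (butlast (zs ! i)) = ys ! i" if "i < length ys" for i
        using zs[OF that] by (auto simp: Tl_def T_take butlast_conv_take min_def)
      \<comment> \<open>Well defined on the nodes below \<open>zs\<close>, because their prefixes of
        length \<open>Suc l\<close> are the distinct entries of \<open>ys\<close>.\<close>
      define \<sigma> where "\<sigma> u = (if \<exists>i<length ys. u = butlast (zs ! i) then zs ! (THE i. i < length ys \<and> u = butlast (zs ! i))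
        else u @ [Nd 0 []])" for u
      have \<sigma>_eq: "\<sigma> (butlast (zs ! i)) = zs ! i" if i: "i < length ys" for i
      proof -
        have "(THE i'. i' < length ys \<and> butlast (zs ! i) = butlast (zs ! i')) = i"
        proof (rule the_equality)
          fix i' assume "i' < length ys \<and> butlast (zs ! i) = butlast (zs ! i')"
          then have "ys ! i = ys ! i'" using bl(2) i by metis
          then show "i' = i" using ysl(2) i \<open>i' < length ys \<and> _\<close> by (simp add: nth_eq_iff_index_eq)
        qed (use i in simp)
        then show ?thesis using i by (auto simp: \<sigma>_def)
      qed
      have \<sigma>: "\<sigma> \<in> Sec (Suc (l + j))"
        unfolding Sec_def
      proof (intro CollectI conjI ballI allI impI)
        fix u assume u: "u \<in> Tl (Suc (l + j))"
        show "\<sigma> u \<in> Tl (Suc (Suc (l + j)))" "butlast (\<sigma> u) = u"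
        proof (atomize (full), cases "\<exists>i<length ys. u = butlast (zs ! i)")
          case True then show "\<sigma> u \<in> Tl (Suc (Suc (l + j))) \<and> butlast (\<sigma> u) = u" using \<sigma>_eq zs by auto
        next
          case False then show "\<sigma> u \<in> Tl (Suc (Suc (l + j))) \<and> butlast (\<sigma> u) = u"
            using u by (auto simp: \<sigma>_def Tl_def T_snoc)
        qed
      next
        fix u assume "u \<notin> Tl (Suc (l + j))"
        then show "\<sigma> u = u @ [Nd 0 []]" using bl by (auto simp: \<sigma>_def)
      qed
      \<comment> \<open>After the word of stage \<open>l + j\<close> come the forced letter and
        \<open>v\<close>, both read through \<open>\<sigma>\<close>. Evaluated at
        \<open>butlast z\<close>, they spell the growth of \<open>z\<close>.\<close>
      let ?v = "w (l + j) @ (lt (F (l + j)) \<circ> \<sigma>) # map (\<lambda>F. F \<circ> \<sigma>) v"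
      have v: "?v \<in> B (l + j)" using Bsec[of v "l + j" \<sigma>] Suc.prems(2) \<sigma> by simp
      have "list_all2 (\<lambda>y z. z \<in> Tl (Suc l + j) \<and> take (Suc l) z = y) ys (map butlast zs)"
        using bl len by (auto simp: list_all2_conv_all_nth)
      from Suc.IH[OF this v] have "\<chi> (map \<phi> ds) (map (ext \<phi> ?v) (map butlast zs)) = c" .
      moreover have "map (ext \<phi> ?v) (map butlast zs) = map (ext \<phi> v) zs"
      proof (rule nth_equalityI)
        fix i assume "i < length (map (ext \<phi> ?v) (map butlast zs))"
        then have i: "i < length ys" using len by simp
        let ?z = "zs ! i"
        have "ext \<phi> ?v (butlast ?z) = eta (\<phi> (butlast (butlast ?z)) @ lt \<phi> (butlast ?z) # map (\<lambda>F. F (butlast ?z)) ?v)"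
          by (simp add: ext_def)
        also have "map (\<lambda>F. F (butlast ?z)) ?v = map (\<lambda>F. F (butlast ?z)) (w (l + j)) @ lt \<phi> ?z # map (\<lambda>F. F ?z) v"
          using \<sigma>_eq[OF i] lt_F[of ?z "Suc (Suc (l + j))" "l + j"] zs[OF i] by simp
        also have "eta (\<phi> (butlast (butlast ?z)) @ lt \<phi> (butlast ?z) # (map (\<lambda>F. F (butlast ?z)) (w (l + j)) @ lt \<phi> ?z # map (\<lambda>F. F ?z) v))
          = eta (\<phi> (butlast ?z) @ lt \<phi> ?z # map (\<lambda>F. F ?z) v)"
          unfolding \<phi>_Suc[OF bl(1)[OF i]] ext_def eta_eta_append by simp
        finally have "ext \<phi> ?v (butlast ?z) = ext \<phi> v ?z" by (simp only: ext_def)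
        then show "map (ext \<phi> ?v) (map butlast zs) ! i = map (ext \<phi> v) zs ! i"
          using i len by (simp only: nth_map length_map)
      qed simp
      ultimately show ?case by (simp only:)
    qed
    have "\<chi> (map \<phi> ds) (map \<phi> zs) = c"
      if L: "L > l" and zs: "list_all2 (\<lambda>y z. z \<in> Tl L \<and> take (Suc l) z = y) ys zs" for L zs
    proof -
      obtain j where j: "L = Suc l + j" using L less_iff_Suc_add by auto
      have "set zs \<subseteq> Tl (Suc (l + j))" using zs j by (auto simp: list_all2_conv_all_nth in_set_conv_nth)
      then have mz: "map \<phi> zs = map (ext \<phi> (w (l + j))) zs" using \<phi>_Suc by auto
      have "\<chi> (map \<phi> ds) (map (ext \<phi> (w (l + j))) zs) = c" by (rule main[OF _ wB]) (use zs j in simp)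
      then show ?thesis by (simp only: mz)
    qed
    then show ?thesis by blast
  qed
  ultimately show ?thesis by blast
qed

section \<open>Types of finite configurations\<close>

text \<open>
  A configuration is explored level by level. Its state consists of the nodes ds that have
  already ended and the nodes as that are still growing. An event is a level at which nodes end
  or split: an entry (i, N, k) continues the i-th growing node by the letter Nd N (ds ! k).
  Between events the growing nodes are extended arbitrarily.
\<close>

type_synonym event = "(nat \<times> nat \<times> nat) list"

definition newalive :: "event \<Rightarrow> nd list list \<Rightarrow> nd list list \<Rightarrow> nd list list" where
  "newalive \<epsilon> ds as = map (\<lambda>(i, N, k). as ! i @ [Nd N (ds ! k)]) \<epsilon>"

definition grown :: "nd list list \<Rightarrow> nd list list \<Rightarrow> bool" where
  "grown ys zs \<longleftrightarrow> (\<exists>L. list_all2 (\<lambda>y z. z \<in> Tl L \<and> take (length y) z = y) ys zs)"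

definition valid_event :: "event \<Rightarrow> nd list list \<Rightarrow> nd list list \<Rightarrow> bool" where
  "valid_event \<epsilon> ds as \<longleftrightarrow> (\<forall>(i, N, k)\<in>set \<epsilon>. i < length as \<and> k < length ds) \<and>
     set (newalive \<epsilon> ds as) \<subseteq> T \<and> distinct (newalive \<epsilon> ds as)"

text \<open>The latest event heads the list. At an event all growing nodes join \<open>ds\<close>,
  also those that continue; appending keeps earlier indices valid. The root state admits no growth
  before the first event.\<close>

fun reachable :: "event list \<Rightarrow> (nd list list \<times> nd list list) set" where
  "reachable [] = {([[]], [[]])}"
| "reachable (\<epsilon> # \<tau>) = {(ds @ as, zs) | ds as zs. (ds, as) \<in> reachable \<tau> \<and> valid_event \<epsilon> ds as \<and> grown (newalive \<epsilon> ds as) zs}"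

section \<open>Levels and sizes of reachable states\<close>

lemma newalive_level:
  assumes "set as \<subseteq> Tl l" "valid_event \<epsilon> ds as"
  shows "set (newalive \<epsilon> ds as) \<subseteq> Tl (Suc l)"
  using assms unfolding valid_event_def newalive_def by (fastforce simp: Tl_def subset_iff)

lemma grown_level:
  assumes "set ys \<subseteq> Tl (Suc l)" "grown ys zs"
  shows "\<exists>L>l. list_all2 (\<lambda>y z. z \<in> Tl L \<and> take (Suc l) z = y) ys zs"
proof (cases ys)
  case Nil then show ?thesis using assms by (auto simp: grown_def)
next
  case (Cons y ys')
  obtain L where L: "list_all2 (\<lambda>y z. z \<in> Tl L \<and> take (length y) z = y) ys zs"
    using assms by (auto simp: grown_def)
  moreover have "length (ys ! i) = Suc l" if "i < length ys" for i
    using assms(1) nth_mem[OF that] by (auto simp: Tl_def)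
  ultimately have "list_all2 (\<lambda>y z. z \<in> Tl L \<and> take (Suc l) z = y) ys zs"
    by (simp add: list_all2_conv_all_nth)
  moreover have "L > l"
  proof -
    obtain z where z: "z \<in> Tl L" "take (length y) z = y" using L Cons by (auto simp: list_all2_Cons1)
    have "length y = Suc l" using assms(1) Cons by (auto simp: Tl_def)
    moreover have "length (take (length y) z) = length y" using z(2) by simp
    ultimately show ?thesis using z(1) by (simp add: Tl_def min_def split: if_splits)
  qed
  ultimately show ?thesis by blast
qed

lemma reachable_level:
  "(ds, as) \<in> reachable \<tau> \<Longrightarrow> \<exists>l. set as \<subseteq> Tl l \<and> (\<forall>d\<in>set ds. d \<in> T \<and> length d \<le> l)"
proof (induction \<tau> arbitrary: ds as)
  case Nil then show ?case by (auto simp: Tl_def)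
next
  case (Cons \<epsilon> \<tau>)
  then obtain ds' as' where st: "(ds', as') \<in> reachable \<tau>" "valid_event \<epsilon> ds' as'" "grown (newalive \<epsilon> ds' as') as" "ds = ds' @ as'"
    by auto
  obtain l where l: "set as' \<subseteq> Tl l" "\<forall>d\<in>set ds'. d \<in> T \<and> length d \<le> l" using Cons.IH[OF st(1)] by blast
  obtain L where L: "L > l" "list_all2 (\<lambda>y z. z \<in> Tl L \<and> take (Suc l) z = y) (newalive \<epsilon> ds' as') as"
    using grown_level[OF newalive_level[OF l(1) st(2)] st(3)] by blast
  have "set as \<subseteq> Tl L" using L(2) by (auto simp: list_all2_conv_all_nth in_set_conv_nth)
  moreover have "\<forall>d\<in>set ds. d \<in> T \<and> length d \<le> L" using l L(1) st(4) by (fastforce simp: Tl_def)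
  ultimately show ?case by blast
qed

lemma grown_length: "grown ys zs \<Longrightarrow> length zs = length ys"
  by (auto simp: grown_def list_all2_conv_all_nth)

lemma reachable_bound: "\<exists>P. \<forall>(ds, as)\<in>reachable \<tau>. length ds \<le> P \<and> length as \<le> P"
proof (induction \<tau>)
  case Nil then show ?case by (auto intro: exI[of _ 1])
next
  case (Cons \<epsilon> \<tau>)
  then obtain P where P: "\<forall>(ds, as)\<in>reachable \<tau>. length ds \<le> P \<and> length as \<le> P" by blast
  show ?case
    by (rule exI[of _ "P + P + length \<epsilon>"]) (use P in \<open>fastforce dest: grown_length simp: newalive_def\<close>)
qed

section \<open>Types are invariant under copies\<close>

lemma copy_post:
  assumes c: "copy m \<phi>" and y: "u @ [Nd N d] \<in> T"
  shows "take (Suc (m (length u))) (\<phi> (u @ [Nd N d])) = \<phi> u @ [Nd N (\<phi> d)]"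
proof -
  have "m (length u) < length (\<phi> (u @ [Nd N d]))"
    using copy_length[OF c y] copy_strict_mono[OF c] by (simp add: strict_mono_less)
  then show ?thesis
    using copy_take[OF c y, of "length u"] copy_nth[OF c y, of "length u"] by (simp add: take_Suc_conv_app_nth)
qed

text \<open>A copy keeps the number of a letter and maps its subnode, which has the same index in
  the mapped list; so the same entries describe the event at level \<open>m l\<close>. The images
  cut off right above \<open>m l\<close> are the new growing nodes, the rest counts as
  growth.\<close>

lemma copy_event:
  assumes c: "copy m \<phi>" and l: "set as \<subseteq> Tl l" "set ds \<subseteq> T"
    and v: "valid_event \<epsilon> ds as" and g: "grown (newalive \<epsilon> ds as) zs"
  shows "valid_event \<epsilon> (map \<phi> ds) (map \<phi> as) \<and> grown (newalive \<epsilon> (map \<phi> ds) (map \<phi> as)) (map \<phi> zs)"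
proof -
  let ?ys = "newalive \<epsilon> ds as"
  have rng: "\<And>i N k. (i, N, k) \<in> set \<epsilon> \<Longrightarrow> i < length as \<and> k < length ds" using v by (auto simp: valid_event_def)
  have ysl: "set ?ys \<subseteq> Tl (Suc l)" by (rule newalive_level[OF l(1) v])
  have inT: "as ! i @ [Nd N (ds ! k)] \<in> T" if "(i, N, k) \<in> set \<epsilon>" for i N k
    using v that by (force simp: valid_event_def newalive_def)
  have asl: "as ! i \<in> T" "length (as ! i) = l" if "i < length as" for i
    using l(1) nth_mem[OF that] by (auto simp: Tl_def)
  have post: "take (Suc (m l)) (\<phi> (as ! i @ [Nd N (ds ! k)])) = \<phi> (as ! i) @ [Nd N (\<phi> (ds ! k))]" if "(i, N, k) \<in> set \<epsilon>" for i N k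
    using copy_post[OF c inT[OF that]] asl rng[OF that] by simp
  have eq: "newalive \<epsilon> (map \<phi> ds) (map \<phi> as) = map (\<lambda>y. take (Suc (m l)) (\<phi> y)) ?ys"
    unfolding newalive_def using rng post by auto
  have inj: "inj_on (\<lambda>y. take (Suc (m l)) (\<phi> y)) (set ?ys)"
  proof (rule inj_onI)
    fix y y' assume y: "y \<in> set ?ys" "y' \<in> set ?ys" and e: "take (Suc (m l)) (\<phi> y) = take (Suc (m l)) (\<phi> y')"
    obtain i N k where ik: "(i, N, k) \<in> set \<epsilon>" "y = as ! i @ [Nd N (ds ! k)]" using y(1) by (auto simp: newalive_def)
    obtain i' N' k' where ik': "(i', N', k') \<in> set \<epsilon>" "y' = as ! i' @ [Nd N' (ds ! k')]" using y(2) by (auto simp: newalive_def)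
    have "\<phi> (as ! i) = \<phi> (as ! i')" "N = N'" "\<phi> (ds ! k) = \<phi> (ds ! k')"
      using e post[OF ik(1)] post[OF ik'(1)] ik ik' by auto
    moreover have "as ! i \<in> T" "as ! i' \<in> T" using asl rng[OF ik(1)] rng[OF ik'(1)] by auto
    moreover have "ds ! k \<in> T" "ds ! k' \<in> T" using l(2) rng[OF ik(1)] rng[OF ik'(1)] nth_mem by blast+
    ultimately show "y = y'" using copy_inj[OF c] ik ik' by (auto simp: inj_on_def)
  qed
  have "set ?ys \<subseteq> T" "distinct ?ys" using v by (auto simp: valid_event_def)
  then have "valid_event \<epsilon> (map \<phi> ds) (map \<phi> as)"
    unfolding valid_event_def eq using rng inj by (auto simp: distinct_map intro: T_take copy_in_T[OF c])
  moreover have "grown (newalive \<epsilon> (map \<phi> ds) (map \<phi> as)) (map \<phi> zs)"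
  proof -
    obtain L where L: "L > l" "list_all2 (\<lambda>y z. z \<in> Tl L \<and> take (Suc l) z = y) ?ys zs"
      using grown_level[OF ysl g] by blast
    have "\<phi> z \<in> Tl (m L) \<and> take (length (take (Suc (m l)) (\<phi> y))) (\<phi> z) = take (Suc (m l)) (\<phi> y)"
      if z: "z \<in> Tl L" "take (Suc l) z = y" for y z
    proof -
      have zT: "z \<in> T" "length z = L" using z by (auto simp: Tl_def)
      have ml: "Suc (m l) \<le> m (Suc l)" using copy_strict_mono[OF c] by (simp add: strict_mono_less Suc_le_eq)
      have "take (m (Suc l)) (\<phi> z) = \<phi> y"
      proof (cases "Suc l = L")
        case True then show ?thesis using z zT copy_length[OF c zT(1)] by simp
      next
        case False then show ?thesis using copy_take[OF c zT(1), of "Suc l"] zT L(1) z(2) by simp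
      qed
      then have "take (Suc (m l)) (\<phi> z) = take (Suc (m l)) (\<phi> y)" using ml by (metis min_def take_take)
      moreover have "length y = Suc l" using z(2) zT(2) L(1) by auto
      then have "length (\<phi> y) = m (Suc l)" using copy_length[OF c, of y] z(2) T_take[OF zT(1)] by auto
      ultimately show ?thesis using copy_in_T[OF c zT(1)] copy_length[OF c zT(1)] zT ml by (simp add: Tl_def min_def)
    qed
    then show ?thesis unfolding grown_def eq using L(2)
      by (intro exI[of _ "m L"]) (auto simp: list_all2_conv_all_nth)
  qed
  ultimately show ?thesis by blast
qed

lemma reachable_copy:
  assumes c: "copy m \<phi>" shows "(ds, as) \<in> reachable \<tau> \<Longrightarrow> (map \<phi> ds, map \<phi> as) \<in> reachable \<tau>"
proof (induction \<tau> arbitrary: ds as)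
  case Nil
  have "\<phi> [] = []" using copy_length[OF c, of "[]"] copy_0[OF c] by simp
  then show ?case using Nil by simp
next
  case (Cons \<epsilon> \<tau>)
  then obtain ds' as' where st: "(ds', as') \<in> reachable \<tau>" "valid_event \<epsilon> ds' as'" "grown (newalive \<epsilon> ds' as') as" "ds = ds' @ as'"
    by auto
  obtain l where l: "set as' \<subseteq> Tl l" "set ds' \<subseteq> T" using reachable_level[OF st(1)] by blast
  show ?case using Cons.IH[OF st(1)] copy_event[OF c l st(2,3)] st(4) by auto
qed

text \<open>\<open>one_step\<close> removes the dependence on the last growth, so what remains is a
  colouring of states before the last event, to which the induction hypothesis applies.\<close>

lemma ramsey_reachable:
  fixes \<chi> :: "nd list list \<Rightarrow> nd list list \<Rightarrow> nat"
  assumes "\<And>ds zs. \<chi> ds zs < k"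
  shows "\<exists>m \<phi> c. copy m \<phi> \<and> (\<forall>(ds, as)\<in>reachable \<tau>. \<chi> (map \<phi> ds) (map \<phi> as) = c)"
  using assms
proof (induction \<tau> arbitrary: \<chi>)
  case Nil
  then show ?case using copy_id by (intro exI[of _ "\<lambda>i. i"] exI[of _ "\<lambda>x. x"] exI[of _ "\<chi> [[]] [[]]"]) simp
next
  case (Cons \<epsilon> \<tau>)
  obtain P where P: "\<forall>(ds, as)\<in>reachable (\<epsilon> # \<tau>). length ds \<le> P \<and> length as \<le> P" using reachable_bound by blast
  obtain m \<phi> where c: "copy m \<phi>" and const: "\<forall>l. \<forall>(ds, ys)\<in>events P l. \<exists>c. \<forall>L zs. L > l \<longrightarrow>
     list_all2 (\<lambda>y z. z \<in> Tl L \<and> take (Suc l) z = y) ys zs \<longrightarrow> \<chi> (map \<phi> ds) (map \<phi> zs) = c"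
    using one_step[where \<chi> = \<chi> and P = P, OF Cons.prems] by (elim exE conjE) (rule that)
  \<comment> \<open>Any growth after the event has the same colour, so the state is coloured by the
    simplest one: none at all.\<close>
  define \<chi>' where "\<chi>' ds as = \<chi> (map \<phi> (ds @ as)) (map \<phi> (newalive \<epsilon> ds as))" for ds as
  have "\<And>ds as. \<chi>' ds as < k" by (simp add: \<chi>'_def Cons.prems)
  from Cons.IH[of \<chi>', OF this] obtain m' \<phi>' col where c': "copy m' \<phi>'"
    and "\<forall>(ds, as)\<in>reachable \<tau>. \<chi>' (map \<phi>' ds) (map \<phi>' as) = col" by blast
  then have col: "\<And>ds as. (ds, as) \<in> reachable \<tau> \<Longrightarrow> \<chi>' (map \<phi>' ds) (map \<phi>' as) = col" by auto
  have "\<chi> (map (\<phi> \<circ> \<phi>') D) (map (\<phi> \<circ> \<phi>') zs) = col" if D: "(D, zs) \<in> reachable (\<epsilon> # \<tau>)" for D zs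
  proof -
    obtain ds as where st: "(ds, as) \<in> reachable \<tau>" "valid_event \<epsilon> ds as" "grown (newalive \<epsilon> ds as) zs" "D = ds @ as"
      using D by auto
    have len: "length D \<le> P" "length zs \<le> P" using P D by auto
    have st': "(map \<phi>' ds, map \<phi>' as) \<in> reachable \<tau>" using reachable_copy[OF c' st(1)] .
    obtain l0 where l0: "set as \<subseteq> Tl l0" "set ds \<subseteq> T" using reachable_level[OF st(1)] by blast
    have ev: "valid_event \<epsilon> (map \<phi>' ds) (map \<phi>' as)" and gr: "grown (newalive \<epsilon> (map \<phi>' ds) (map \<phi>' as)) (map \<phi>' zs)"
      using copy_event[OF c' l0 st(2,3)] by auto
    obtain l where l: "set (map \<phi>' as) \<subseteq> Tl l" "\<forall>d\<in>set (map \<phi>' ds). d \<in> T \<and> length d \<le> l"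
      using reachable_level[OF st'] by blast
    let ?ds = "map \<phi>' ds @ map \<phi>' as" and ?ys = "newalive \<epsilon> (map \<phi>' ds) (map \<phi>' as)"
    have ysl: "set ?ys \<subseteq> Tl (Suc l)" by (rule newalive_level[OF l(1) ev])
    have "(?ds, ?ys) \<in> events P l"
      using l len st(4) ev ysl grown_length[OF gr] by (auto simp: events_def Tl_def valid_event_def)
    then obtain c0 where c0: "\<And>L zs. L > l \<Longrightarrow> list_all2 (\<lambda>y z. z \<in> Tl L \<and> take (Suc l) z = y) ?ys zs \<Longrightarrow> \<chi> (map \<phi> ?ds) (map \<phi> zs) = c0"
      using const[rule_format, of "(?ds, ?ys)" l] by auto
    obtain L where L: "L > l" "list_all2 (\<lambda>y z. z \<in> Tl L \<and> take (Suc l) z = y) ?ys (map \<phi>' zs)"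
      using grown_level[OF ysl gr] by blast
    have "\<chi> (map \<phi> ?ds) (map \<phi> (map \<phi>' zs)) = c0" by (rule c0[OF L])
    also have "\<chi> (map \<phi> ?ds) (map \<phi> ?ys) = c0"
      by (rule c0[of "Suc l"]) (use ysl in \<open>auto simp: list_all2_conv_all_nth Tl_def dest!: nth_mem\<close>)
    then have "c0 = \<chi>' (map \<phi>' ds) (map \<phi>' as)" by (simp add: \<chi>'_def)
    also have "\<dots> = col" by (rule col[OF st(1)])
    finally show ?thesis by (simp add: st(4))
  qed
  then show ?case using copy_comp[OF c c'] by (intro exI[of _ "m \<circ> m'"] exI[of _ "\<phi> \<circ> \<phi>'"] exI[of _ col]) blast
qed

text \<open>Types are treated one after another. A further copy maps states to states of the same
  type, so earlier homogeneity survives the composition.\<close>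

lemma ramsey_types:
  fixes \<chi> :: "nd list list \<Rightarrow> nat"
  assumes k: "\<And>zs. \<chi> zs < k" and "finite \<Theta>"
  shows "\<exists>m \<phi>. copy m \<phi> \<and> (\<forall>(\<tau>, pos)\<in>\<Theta>. \<exists>c. \<forall>(ds, as)\<in>reachable \<tau>. (\<forall>i\<in>set pos. i < length ds) \<longrightarrow>
     \<chi> (map (\<lambda>i. \<phi> (ds ! i)) pos) = c)"
  using assms(2)
proof (induction \<Theta>)
  case empty
  then show ?case using copy_id by auto
next
  case (insert x \<Theta>)
  obtain \<tau> pos where x: "x = (\<tau>, pos)" by (cases x)
  obtain m \<phi> where c: "copy m \<phi>" and hom: "\<And>\<tau> pos. (\<tau>, pos) \<in> \<Theta> \<Longrightarrow> \<exists>c. \<forall>(ds, as)\<in>reachable \<tau>. (\<forall>i\<in>set pos. i < length ds) \<longrightarrow>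
     \<chi> (map (\<lambda>i. \<phi> (ds ! i)) pos) = c" using insert.IH by blast
  obtain m' \<phi>' col where c': "copy m' \<phi>'"
    and "\<forall>(ds, as)\<in>reachable \<tau>. \<chi> (map (\<lambda>i. \<phi> (map \<phi>' ds ! i)) pos) = col"
    using ramsey_reachable[where \<tau> = \<tau> and k = k and \<chi> = "\<lambda>ds as. \<chi> (map (\<lambda>i. \<phi> (ds ! i)) pos)"] k by blast
  then have col: "\<And>ds as. (ds, as) \<in> reachable \<tau> \<Longrightarrow> \<chi> (map (\<lambda>i. \<phi> (map \<phi>' ds ! i)) pos) = col" by auto
  have "\<exists>c. \<forall>(ds, as)\<in>reachable \<tau>'. (\<forall>i\<in>set pos'. i < length ds) \<longrightarrow> \<chi> (map (\<lambda>i. (\<phi> \<circ> \<phi>') (ds ! i)) pos') = c"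
    if m: "(\<tau>', pos') \<in> insert x \<Theta>" for \<tau>' pos'
  proof (cases "(\<tau>', pos') \<in> \<Theta>")
    case True
    then obtain c0 where c0: "\<And>ds as. (ds, as) \<in> reachable \<tau>' \<Longrightarrow> (\<forall>i\<in>set pos'. i < length ds) \<Longrightarrow> \<chi> (map (\<lambda>i. \<phi> (ds ! i)) pos') = c0"
      using hom by blast
    have "\<chi> (map (\<lambda>i. (\<phi> \<circ> \<phi>') (ds ! i)) pos') = c0" if "(ds, as) \<in> reachable \<tau>'" "\<forall>i\<in>set pos'. i < length ds" for ds as
    proof -
      have "map (\<lambda>i. (\<phi> \<circ> \<phi>') (ds ! i)) pos' = map (\<lambda>i. \<phi> (map \<phi>' ds ! i)) pos'" using that(2) by auto
      moreover have "\<chi> (map (\<lambda>i. \<phi> (map \<phi>' ds ! i)) pos') = c0" using c0[OF reachable_copy[OF c' that(1)]] that(2) by simp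
      ultimately show ?thesis by (simp only:)
    qed
    then show ?thesis by blast
  next
    case False
    then have eq: "\<tau>' = \<tau>" "pos' = pos" using m x by auto
    have "\<chi> (map (\<lambda>i. (\<phi> \<circ> \<phi>') (ds ! i)) pos') = col" if "(ds, as) \<in> reachable \<tau>'" "\<forall>i\<in>set pos'. i < length ds" for ds as
    proof -
      have "map (\<lambda>i. (\<phi> \<circ> \<phi>') (ds ! i)) pos' = map (\<lambda>i. \<phi> (map \<phi>' ds ! i)) pos'" using that(2) by auto
      then show ?thesis using col[OF that(1)[unfolded eq]] unfolding eq by (simp only:)
    qed
    then show ?thesis by blast
  qed
  then show ?case using copy_comp[OF c c'] by (intro exI[of _ "m \<circ> m'"] exI[of _ "\<phi> \<circ> \<phi>'"]) blast
qed

text \<open>The levels that need an event. Level 0 is always included, since the root state cannot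
  grow before the first event.\<close>

definition rlevels :: "nd list set \<Rightarrow> nat set" where
  "rlevels X = {p. p = 0 \<or> (\<exists>x\<in>X. length x = p) \<or>
     (\<exists>x\<in>X. \<exists>x'\<in>X. p < length x \<and> p < length x' \<and> take p x = take p x' \<and> x ! p \<noteq> x' ! p)}"

text \<open>One for level 0, \<open>B\<close> for the ends, and \<open>B * B\<close> for pairs of
  nodes, which split at most once, at their first difference.\<close>

lemma card_rlevels:
  assumes "finite X" "card X \<le> B"
  shows "finite (rlevels X)" "card (rlevels X) \<le> Suc (B + B * B)"
proof -
  define sp where "sp = (\<lambda>(x :: nd list, x'). LEAST p. x ! p \<noteq> x' ! p)"
  have sub: "rlevels X \<subseteq> {0} \<union> (length ` X \<union> sp ` (X \<times> X))"
  proof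
    fix p assume "p \<in> rlevels X"
    moreover have "p \<in> sp ` (X \<times> X)"
      if xx: "x \<in> X" "x' \<in> X" "p < length x" "p < length x'" "take p x = take p x'" "x ! p \<noteq> x' ! p" for x x'
    proof -
      have "sp (x, x') = p" unfolding sp_def prod.case
      proof (rule Least_equality)
        fix q assume q: "x ! q \<noteq> x' ! q"
        show "p \<le> q"
        proof (rule ccontr)
          assume "\<not> p \<le> q"
          then have "take p x ! q = x ! q" "take p x' ! q = x' ! q" by auto
          then show False using q xx(5) by simp
        qed
      qed (rule xx)
      then show ?thesis using xx(1,2) by force
    qed
    ultimately show "p \<in> {0} \<union> (length ` X \<union> sp ` (X \<times> X))" unfolding rlevels_def by blast
  qed
  have fin: "finite ({0} \<union> (length ` X \<union> sp ` (X \<times> X)))" using assms by simp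
  have "card ({0} \<union> (length ` X \<union> sp ` (X \<times> X))) \<le> 1 + (card X + card X * card X)"
  proof -
    have "card (sp ` (X \<times> X)) \<le> card X * card X" using assms(1) card_image_le[of "X \<times> X" sp] by (simp add: card_cartesian_product)
    then have "card (length ` X \<union> sp ` (X \<times> X)) \<le> card X + card X * card X"
      using card_Un_le[of "length ` X" "sp ` (X \<times> X)"] card_image_le[OF assms(1), of length] by linarith
    then show ?thesis using card_Un_le[of "{0}" "length ` X \<union> sp ` (X \<times> X)"] by simp
  qed
  moreover have "1 + (card X + card X * card X) \<le> Suc (B + B * B)"
    using assms(2) by (simp add: add_mono mult_le_mono)
  ultimately show "card (rlevels X) \<le> Suc (B + B * B)"
    using card_mono[OF fin sub] by linarith
  show "finite (rlevels X)" by (rule finite_subset[OF sub fin])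
qed

text \<open>The list \<open>ds\<close> starts with the root alone, and each of at most
  \<open>Suc (B + B * B)\<close> events appends at most \<open>B\<close> nodes.\<close>

definition ds_bound :: "nat \<Rightarrow> nat" where "ds_bound B = Suc (B * Suc (B + B * B))"

definition types :: "nat \<Rightarrow> nat \<Rightarrow> event list set" where
  "types B b = {\<tau>. set \<tau> \<subseteq> {\<epsilon>. set \<epsilon> \<subseteq> {..<B} \<times> {..<b} \<times> {..<ds_bound B} \<and> length \<epsilon> \<le> B} \<and> length \<tau> \<le> Suc (B + B * B)}"

lemma finite_types: "finite (types B b)"
  unfolding types_def by (intro finite_lists_length_le) auto

lemma reachable_grow:
  assumes "(ds, as) \<in> reachable \<tau>" "\<tau> \<noteq> []" "list_all2 (\<lambda>a z. z \<in> Tl L \<and> take (length a) z = a) as zs"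
  shows "(ds, zs) \<in> reachable \<tau>"
proof -
  obtain \<epsilon> \<tau>' where \<tau>: "\<tau> = \<epsilon> # \<tau>'" using assms(2) by (cases \<tau>) auto
  obtain ds' as' where st: "(ds', as') \<in> reachable \<tau>'" "valid_event \<epsilon> ds' as'" "grown (newalive \<epsilon> ds' as') as" "ds = ds' @ as'"
    using assms(1) \<tau> by auto
  have "grown (newalive \<epsilon> ds' as') zs"
  proof -
    obtain K where K: "list_all2 (\<lambda>y z. z \<in> Tl K \<and> take (length y) z = y) (newalive \<epsilon> ds' as') as"
      using st(3) by (auto simp: grown_def)
    have "z \<in> Tl L \<and> take (length y) z = y"
      if "take (length y) a = y" "z \<in> Tl L \<and> take (length a) z = a" for y a z
    proof -
      have "length y \<le> length a" using that(1) by (metis length_take min.bounded_iff order_refl)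
      then show ?thesis using that by (metis min.absorb1 take_take)
    qed
    then show ?thesis using K assms(3) unfolding grown_def
      by (intro exI[of _ L]) (auto simp: list_all2_conv_all_nth)
  qed
  then show ?thesis using st \<tau> by auto
qed

text \<open>A sweep through the levels, with the prefixes of length \<open>p\<close> as growing
  nodes. Outside \<open>rlevels X\<close> every prefix has a unique continuation, which counts as
  growth; at relevant levels, \<open>cl\<close> allows the next letter to be named by bounded
  data.\<close>

lemma configuration_type:
  assumes X: "finite X" "X \<subseteq> T" "[] \<in> X" "card X \<le> B"
    and cl: "\<And>x p. x \<in> X \<Longrightarrow> p < length x \<Longrightarrow> p \<in> rlevels X \<Longrightarrow> pay (x ! p) < b \<and> (sub (x ! p) = [] \<or> sub (x ! p) \<in> X)"
  shows "\<exists>\<tau>\<in>types B b. \<exists>ds as. (ds, as) \<in> reachable \<tau> \<and> X \<subseteq> set ds \<and> length ds \<le> ds_bound B"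
proof -
  let ?A = "\<lambda>p. {take p x | x. x \<in> X \<and> p \<le> length x}"
  let ?EV = "{\<epsilon>. set \<epsilon> \<subseteq> {..<B} \<times> {..<b} \<times> {..<ds_bound B} \<and> length \<epsilon> \<le> B}"
  let ?Cl = "\<lambda>p \<tau> ds as. (ds, as) \<in> reachable \<tau> \<and> length \<tau> \<le> card (rlevels X \<inter> {..<p}) \<and> set \<tau> \<subseteq> ?EV \<and>
     (0 < p \<longrightarrow> \<tau> \<noteq> []) \<and> set as = ?A p \<and> distinct as \<and> [] \<in> set ds \<and> (\<forall>x\<in>X. length x < p \<longrightarrow> x \<in> set ds) \<and>
     length ds \<le> Suc (B * length \<tau>)"
  have finL: "finite (rlevels X)" and cardL: "card (rlevels X) \<le> Suc (B + B * B)" using card_rlevels[OF X(1,4)] by auto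
  have cardA: "card (?A p) \<le> B" "finite (?A p)" for p
  proof -
    have sub: "?A p \<subseteq> take p ` X" by auto
    show "finite (?A p)" using sub X(1) finite_subset by blast
    have "card (?A p) \<le> card (take p ` X)" using sub X(1) by (intro card_mono) auto
    also have "\<dots> \<le> B" using card_image_le[OF X(1), of "take p"] X(4) by simp
    finally show "card (?A p) \<le> B" .
  qed
  have lenL: "card (rlevels X \<inter> {..<p}) \<le> Suc (B + B * B)" for p
    using card_mono[OF finL, of "rlevels X \<inter> {..<p}"] cardL by simp
  have claim: "\<exists>\<tau> ds as. ?Cl p \<tau> ds as" for p
  proof (induction p)
    case 0
    have "?A 0 = {[]}" using X(3) by auto
    then show ?case by (intro exI[of _ "[]"] exI[of _ "[[]]"]) simp
  next
    case (Suc p)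
    then obtain \<tau> ds as where IH: "?Cl p \<tau> ds as" by blast
    have as_A: "set as = ?A p" and r: "(ds, as) \<in> reachable \<tau>" using IH by auto
    have lenas: "length as \<le> B" using IH cardA(1)[of p] by (metis (no_types, lifting) distinct_card)
    have AT: "?A q \<subseteq> Tl q" for q using X(2) by (auto simp: Tl_def T_take)
    show ?case
    proof (cases "p \<in> rlevels X")
      case False
      then have p0: "p \<noteq> 0" and nl: "\<And>x. x \<in> X \<Longrightarrow> length x \<noteq> p" by (auto simp: rlevels_def)
      have ns: "x ! p = x' ! p" if "x \<in> X" "x' \<in> X" "p < length x" "p < length x'" "take p x = take p x'" for x x'
      proof (rule ccontr)
        assume "x ! p \<noteq> x' ! p"
        then have "p \<in> rlevels X" unfolding rlevels_def using that by blast
        then show False using False by contradiction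
      qed
      have "\<forall>a\<in>set as. \<exists>x\<in>X. p < length x \<and> take p x = a"
      proof
        fix a assume "a \<in> set as"
        then obtain x where x: "x \<in> X" "p \<le> length x" "take p x = a" unfolding as_A by blast
        then have "p < length x" using nl[of x] by simp
        then show "\<exists>x\<in>X. p < length x \<and> take p x = a" using x by blast
      qed
      then obtain g where g: "\<And>a. a \<in> set as \<Longrightarrow> g a \<in> X \<and> p < length (g a) \<and> take p (g a) = a" by metis
      define nx where "nx a = take (Suc p) (g a)" for a
      have nx_take: "take p (nx a) = a" if "a \<in> set as" for a using g[OF that] by (simp add: nx_def)
      have nx_eq: "nx (take p x) = take (Suc p) x" if x: "x \<in> X" "p < length x" for x
      proof -
        have a: "take p x \<in> set as" unfolding as_A using x by auto
        have "g (take p x) ! p = x ! p" using ns[of "g (take p x)" x] g[OF a] x by auto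
        then show ?thesis using g[OF a] x by (simp add: nx_def take_Suc_conv_app_nth)
      qed
      have A: "set (map nx as) = ?A (Suc p)"
      proof (intro equalityI subsetI)
        fix y assume "y \<in> set (map nx as)"
        then obtain a where "a \<in> set as" "y = nx a" by auto
        then show "y \<in> ?A (Suc p)" using g[of a] by (auto simp: nx_def intro!: exI[of _ "g a"])
      next
        fix y assume "y \<in> ?A (Suc p)"
        then obtain x where x: "x \<in> X" "p < length x" "y = take (Suc p) x" by auto
        then have "take p x \<in> set as" unfolding as_A by auto
        then show "y \<in> set (map nx as)" using nx_eq[OF x(1,2)] x(3) by force
      qed
      have "inj_on nx (set as)" using nx_take by (metis inj_onI)
      then have "distinct (map nx as)" using IH by (simp add: distinct_map)
      moreover have "list_all2 (\<lambda>a z. z \<in> Tl (Suc p) \<and> take (length a) z = a) as (map nx as)"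
      proof -
        have "nx a \<in> Tl (Suc p) \<and> take (length a) (nx a) = a" if "a \<in> set as" for a
          using A AT[of "Suc p"] AT[of p] as_A nx_take[OF that] that by (auto simp: Tl_def)
        then show ?thesis by (auto simp: list_all2_conv_all_nth)
      qed
      then have "(ds, map nx as) \<in> reachable \<tau>" using reachable_grow[OF r] IH p0 by blast
      moreover have "rlevels X \<inter> {..<Suc p} = rlevels X \<inter> {..<p}" using False by (auto simp: less_Suc_eq)
      moreover have "\<forall>x\<in>X. length x < Suc p \<longrightarrow> x \<in> set ds" using IH nl by (auto simp: less_Suc_eq)
      ultimately have "?Cl (Suc p) \<tau> ds (map nx as)" using IH A p0 by auto
      then show ?thesis by blast
    next
      case True
      obtain ys where ys: "set ys = ?A (Suc p)" "distinct ys" using finite_distinct_list[OF cardA(2)] by blast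
      have lenys: "length ys \<le> B" using ys cardA(1)[of "Suc p"] by (metis (no_types, lifting) distinct_card)
      have dsb: "length ds \<le> ds_bound B"
      proof -
        have "length \<tau> \<le> Suc (B + B * B)" using IH lenL[of p] by linarith
        then have "B * length \<tau> \<le> B * Suc (B + B * B)" by (rule mult_le_mono2)
        then show ?thesis using IH unfolding ds_bound_def by linarith
      qed
      define good where "good y t \<longleftrightarrow> fst t < length as \<and> fst (snd t) < b \<and> snd (snd t) < length ds \<and>
        y = as ! fst t @ [Nd (fst (snd t)) (ds ! snd (snd t))]" for y t
      have "\<exists>t. good y t" if yin: "y \<in> set ys" for y
      proof -
        obtain x where x: "x \<in> X" "p < length x" "y = take (Suc p) x" using yin unfolding ys(1) by (auto simp: Suc_le_eq)
        have "take p x \<in> set as" unfolding as_A using x by auto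
        then obtain i where i: "i < length as" "as ! i = take p x" by (auto simp: in_set_conv_nth)
        have c: "pay (x ! p) < b" "sub (x ! p) = [] \<or> sub (x ! p) \<in> X" using cl[OF x(1,2) True] by auto
        \<comment> \<open>The subnode is the root or shorter than \<open>p\<close>, so it has ended
          already and has an index in \<open>ds\<close>.\<close>
        have "length (sub (x ! p)) \<le> p - 1" using T_sub_length x X(2) by auto
        then have "sub (x ! p) = [] \<or> length (sub (x ! p)) < p" by (cases p) auto
        then have "sub (x ! p) \<in> set ds" using c(2) IH by auto
        then obtain k where k: "k < length ds" "ds ! k = sub (x ! p)" by (auto simp: in_set_conv_nth)
        have "y = as ! i @ [Nd (pay (x ! p)) (ds ! k)]" using x i k by (simp add: take_Suc_conv_app_nth)
        then show ?thesis using i k c by (intro exI[of _ "(i, pay (x ! p), k)"]) (simp add: good_def)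
      qed
      then obtain t where t: "\<And>y. y \<in> set ys \<Longrightarrow> good y (t y)" by metis
      define \<epsilon> where "\<epsilon> = map t ys"
      have new: "newalive \<epsilon> ds as = ys"
        unfolding newalive_def \<epsilon>_def map_map
      proof (rule map_idI)
        fix y assume "y \<in> set ys"
        then have "good y (t y)" by (rule t)
        then show "((\<lambda>(i, N, k). as ! i @ [Nd N (ds ! k)]) \<circ> t) y = y" by (simp add: good_def case_prod_unfold)
      qed
      have ysT: "set ys \<subseteq> Tl (Suc p)" using ys AT by simp
      have rng: "i < length as \<and> N < b \<and> k < length ds" if ik: "(i, N, k) \<in> set \<epsilon>" for i N k
      proof -
        obtain y where "y \<in> set ys" "t y = (i, N, k)" using ik unfolding \<epsilon>_def by (metis (no_types) ex_map_conv image_iff set_map)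
        then show ?thesis using t[of y] by (simp add: good_def)
      qed
      have "valid_event \<epsilon> ds as"
        unfolding valid_event_def new using rng ysT ys(2) by (auto simp: Tl_def)
      moreover have "grown ys ys" unfolding grown_def using ysT
        by (intro exI[of _ "Suc p"]) (auto simp: list_all2_conv_all_nth dest!: nth_mem)
      ultimately have "(ds @ as, ys) \<in> reachable (\<epsilon> # \<tau>)" using r new by auto
      moreover have "rlevels X \<inter> {..<Suc p} = insert p (rlevels X \<inter> {..<p})" using True by (auto simp: less_Suc_eq)
      then have "card (rlevels X \<inter> {..<Suc p}) = Suc (card (rlevels X \<inter> {..<p}))" using finL by simp
      moreover have "set \<epsilon> \<subseteq> {..<B} \<times> {..<b} \<times> {..<ds_bound B}"
        using rng lenas dsb by (force dest: less_le_trans)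
      then have "\<epsilon> \<in> ?EV" using lenys by (simp add: \<epsilon>_def)
      moreover have "\<forall>x\<in>X. length x < Suc p \<longrightarrow> x \<in> set (ds @ as)"
      proof (intro ballI impI)
        fix x assume x: "x \<in> X" "length x < Suc p"
        show "x \<in> set (ds @ as)"
        proof (cases "length x = p")
          case True then have "x \<in> ?A p" using x by force
          then show ?thesis using as_A by simp
        next
          case False then show ?thesis using x IH by auto
        qed
      qed
      ultimately have "?Cl (Suc p) (\<epsilon> # \<tau>) (ds @ as) ys" using IH ys lenas by auto
      then show ?thesis by blast
    qed
  qed
  define p where "p = Suc (Max (length ` X))"
  have lt: "length x < p" if "x \<in> X" for x using that X(1) by (simp add: p_def less_Suc_eq_le)
  obtain \<tau> ds as where C: "?Cl p \<tau> ds as" using claim[of p] by (elim exE) (rule that)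
  have len: "length \<tau> \<le> Suc (B + B * B)" using C lenL[of p] by linarith
  then have "B * length \<tau> \<le> B * Suc (B + B * B)" by (rule mult_le_mono2)
  then have "length ds \<le> ds_bound B" using C unfolding ds_bound_def by linarith
  moreover have "\<tau> \<in> types B b" using C len by (simp add: types_def)
  moreover have "X \<subseteq> set ds" using C lt by blast
  moreover have "(ds, as) \<in> reachable \<tau>" using C by (rule conjunct1)
  ultimately show ?thesis by blast
qed

section \<open>Coding a structure in the tree\<close>

fun rd :: "nd list \<Rightarrow> nat list \<Rightarrow> nat list" where
  "rd x [] = []"
| "rd x (l # ls) = pay (x ! l) # rd (sub (x ! l)) ls"

fun okp :: "nd list \<Rightarrow> nat list \<Rightarrow> bool" where
  "okp x [] = True"
| "okp x (l # ls) = (l < length x \<and> okp (sub (x ! l)) ls)"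

text \<open>A copy moves letters to other levels and maps their subnodes along; only the levels to
  be read change, not the numbers.\<close>

lemma rd_copy:
  assumes "copy m \<phi>" shows "x \<in> T \<Longrightarrow> okp x ls \<Longrightarrow> rd (\<phi> x) (map m ls) = rd x ls"
  by (induction ls arbitrary: x) (auto simp: copy_nth[OF assms] T_sub)

definition chain :: "nat \<Rightarrow> nat list \<Rightarrow> bool" where
  "chain j C \<longleftrightarrow> C \<noteq> [] \<and> sorted_wrt (<) (j # C)"

text \<open>
  A chain j # C lists vertices in increasing order; it is the address of the letter reached from
  the largest vertex by descending through the others. Up to length n a letter stores the pattern
  of its chain. A letter of a chain of length n + 1 stores a representative of all chains with the
  same patterns over smaller vertices, and later letters store the index of the next vertex. Only
  letters of the first kind occur in the type of n vertices, and they are bounded.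
\<close>

definition same_table :: "(nat set \<Rightarrow> nat) \<Rightarrow> nat list \<Rightarrow> nat list \<Rightarrow> bool" where
  "same_table pv C C' \<longleftrightarrow> hd C = hd C' \<and> (\<forall>J. J \<subseteq> {..<hd C} \<longrightarrow> pv (set C' \<union> J) = pv (set C \<union> J))"

definition payload :: "nat \<Rightarrow> (nat set \<Rightarrow> nat) \<Rightarrow> nat list \<Rightarrow> nat" where
  "payload n pv C = (if length C \<le> n then pv (set C)
     else if length C = Suc n then to_nat (SOME C'. same_table pv C C') else hd C)"

text \<open>All that vertices up to \<open>j\<close> can see of \<open>C\<close>. There are
  infinitely many chains above \<open>j\<close>, but by \<open>finite_sig\<close> only finitely many
  signatures of bounded length.\<close>

definition sig :: "(nat set \<Rightarrow> nat) \<Rightarrow> nat \<Rightarrow> nat list \<Rightarrow> nat \<times> (nat set \<Rightarrow> nat)" where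
  "sig pv j C = (length C, restrict (\<lambda>J. pv (set C \<union> J)) (Pow {..j}))"

lemma sig_length: "sig pv j C = sig pv j C' \<Longrightarrow> length C = length C'"
  by (simp add: sig_def)

lemma sig_pv:
  assumes "sig pv j C = sig pv j C'" "J \<subseteq> {..j}" shows "pv (set C \<union> J) = pv (set C' \<union> J)"
proof -
  have "snd (sig pv j C) J = snd (sig pv j C') J" using assms(1) by simp
  then show ?thesis using assms(2) by (simp add: sig_def)
qed

text \<open>For chains of length \<open>Suc n\<close>, equal signatures give equal predicates
  \<open>same_table\<close>, so \<open>SOME\<close> returns the same representative.\<close>

lemma sig_payload:
  assumes s: "sig pv j C = sig pv j C'"
  shows "payload n pv (j # C) = payload n pv (j # C')"
proof -
  have eq: "pv (set (j # C) \<union> J) = pv (set (j # C') \<union> J)" if "J \<subseteq> {..<j}" for J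
  proof -
    have "insert j J \<subseteq> {..j}" using that by force
    from sig_pv[OF s this] show ?thesis by simp
  qed
  have "same_table pv (j # C) = same_table pv (j # C')"
    unfolding same_table_def fun_eq_iff using eq by auto
  then show ?thesis using eq[of "{}"] sig_length[OF s] by (simp add: payload_def)
qed

lemma sig_Cons:
  assumes s: "sig pv j C = sig pv j C'" and i: "i < j"
  shows "sig pv i (j # C) = sig pv i (j # C')"
proof -
  have "pv (set (j # C) \<union> J) = pv (set (j # C') \<union> J)" if "J \<subseteq> {..i}" for J
  proof -
    have "insert j J \<subseteq> {..j}" using that i by force
    from sig_pv[OF s this] show ?thesis by simp
  qed
  then show ?thesis unfolding sig_def using sig_length[OF s] by (auto intro: restrict_ext)
qed

lemma finite_sig:
  assumes fin: "\<And>k. finite (pv ` {J. finite J \<and> card J = k})"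
  shows "finite (sig pv j ` {C. chain j C \<and> length C \<le> N})"
proof (rule finite_subset)
  let ?V = "\<Union>k\<le>N + Suc j. pv ` {J. finite J \<and> card J = k}"
  show "finite ({..N} \<times> PiE (Pow {..j}) (\<lambda>_. ?V))" using fin by (auto intro!: finite_PiE)
  show "sig pv j ` {C. chain j C \<and> length C \<le> N} \<subseteq> {..N} \<times> PiE (Pow {..j}) (\<lambda>_. ?V)"
  proof
    fix s assume "s \<in> sig pv j ` {C. chain j C \<and> length C \<le> N}"
    then obtain C where C: "length C \<le> N" "s = sig pv j C" by auto
    have "pv (set C \<union> J) \<in> ?V" if J: "J \<subseteq> {..j}" for J
    proof -
      have fJ: "finite J" using J by (rule finite_subset) simp
      have "card (set C \<union> J) \<le> card (set C) + card J" by (rule card_Un_le)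
      also have "card J \<le> Suc j" using card_mono[OF _ J] by simp
      also have "card (set C) \<le> N" using card_length[of C] C(1) by simp
      finally show ?thesis using fJ by auto
    qed
    then show "s \<in> {..N} \<times> PiE (Pow {..j}) (\<lambda>_. ?V)" using C by (auto simp: sig_def)
  qed
qed

text \<open>Payloads of chains of length at most \<open>Suc n\<close> factor through finitely many
  signatures, and longer chains store \<open>j\<close>. Hence the level of \<open>j\<close> can be
  chosen above all of them.\<close>

lemma payload_bounded:
  assumes fin: "\<And>k. finite (pv ` {J. finite J \<and> card J = k})"
  shows "\<exists>b. \<forall>C. chain j C \<longrightarrow> payload n pv (j # C) \<le> b"
proof -
  let ?A = "{C. chain j C \<and> length C \<le> n}"
  define g where "g s = payload n pv (j # (SOME C. sig pv j C = s))" for s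
  have "payload n pv (j # C) = g (sig pv j C)" for C
    unfolding g_def by (rule sig_payload) (rule someI2[of _ C], auto)
  then have "(\<lambda>C. payload n pv (j # C)) ` ?A = g ` sig pv j ` ?A" by (simp add: image_image)
  then have "finite ((\<lambda>C. payload n pv (j # C)) ` ?A)" using finite_sig[OF fin] by simp
  then obtain b where "\<forall>x\<in>(\<lambda>C. payload n pv (j # C)) ` ?A. x \<le> b" unfolding finite_nat_set_iff_bounded_le ..
  then have b: "\<And>C. C \<in> ?A \<Longrightarrow> payload n pv (j # C) \<le> b" by blast
  have "payload n pv (j # C) \<le> b + j" if "chain j C" for C
  proof (cases "length C \<le> n")
    case True then show ?thesis using b[of C] that by simp
  next
    case False then show ?thesis by (simp add: payload_def)
  qed
  then show ?thesis by blast
qed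

text \<open>For \<open>k\<close> vertices the list \<open>I\<close> has \<open>k - 1\<close>
  entries, and entry \<open>q\<close> belongs to a chain of length \<open>q + 2\<close>. So position
  \<open>n - 1\<close> holds the representative for the chain of length \<open>n + 1\<close>, and
  the entries from \<open>n\<close> on are the remaining vertices.\<close>

definition dec :: "nat \<Rightarrow> (nat set \<Rightarrow> nat) \<Rightarrow> nat \<Rightarrow> nat list \<Rightarrow> nat" where
  "dec n pv k I = (if k \<le> n then last I else pv (set (from_nat (I ! (n - 1)) :: nat list) \<union> set (drop n I)))"

text \<open>
  Vertex j is coded at level lv j. The levels between lv (j - 1) and lv j contain a single letter
  Nd 1 [], at the position kk j (sig pv j C), which announces the letter at lv j. Thus two nodes
  never split at a coding level, and splittings involve only the letters Nd 0 [] and Nd 1 [].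
\<close>

locale coded =
  fixes n :: nat and pv :: "nat set \<Rightarrow> nat" and lv :: "nat \<Rightarrow> nat" and kk :: "nat \<Rightarrow> nat \<times> (nat set \<Rightarrow> nat) \<Rightarrow> nat" and K :: "nat \<Rightarrow> nat"
  assumes n_pos: "n \<ge> 1"
    and lv_0: "1 + K 0 < lv 0"
    and lv_Suc: "\<And>j. Suc (lv j) + K (Suc j) < lv (Suc j)"
    and lv_payload: "\<And>j C. chain j C \<Longrightarrow> payload n pv (j # C) \<le> lv j"
    and kk_less: "\<And>j C. chain j C \<Longrightarrow> length C \<le> n \<Longrightarrow> kk j (sig pv j C) < K j"
    and kk_inj: "\<And>j C C'. chain j C \<Longrightarrow> length C \<le> n \<Longrightarrow> chain j C' \<Longrightarrow> length C' \<le> n \<Longrightarrow>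
       kk j (sig pv j C) = kk j (sig pv j C') \<Longrightarrow> sig pv j C = sig pv j C'"
begin

text \<open>Block 0 starts at level 1, as the letter \<open>Nd 1 []\<close> is not allowed at level
  0.\<close>

definition base :: "nat \<Rightarrow> nat" where "base j = (case j of 0 \<Rightarrow> 1 | Suc i \<Rightarrow> Suc (lv i))"

lemma base_K: "base j + K j < lv j"
  using lv_0 lv_Suc by (cases j) (auto simp: base_def)

lemma base_pos: "1 \<le> base j" by (cases j) (auto simp: base_def)

lemma lv_strict: "strict_mono lv"
  unfolding strict_mono_Suc_iff using lv_Suc by (meson add_lessD1 less_trans lessI)

lemma lv_base: "i < j \<Longrightarrow> lv i < base j"
proof -
  assume "i < j"
  then obtain j' where "j = Suc j'" "i \<le> j'" by (cases j) auto
  then show ?thesis using lv_strict by (simp add: base_def less_Suc_eq_le strict_mono_less_eq)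
qed

definition blk :: "nat \<Rightarrow> nat" where "blk p = (LEAST j. p \<le> lv j)"

lemma blk_eq: "base j \<le> p \<Longrightarrow> p \<le> lv j \<Longrightarrow> blk p = j"
  unfolding blk_def
proof (rule Least_equality)
  fix i assume "base j \<le> p" "p \<le> lv i"
  then show "j \<le> i" using lv_base[of i j] by (meson leD le_less_trans not_le)
qed

lemma blk_lv [simp]: "blk (lv j) = j"
  using blk_eq[of j "lv j"] base_K[of j] by simp

text \<open>The node of a longer chain is the subnode of a letter at level \<open>lv (hd C)\<close>
  and must be shorter than that level; for a single vertex the length is the coding level
  itself.\<close>

definition len :: "nat list \<Rightarrow> nat" where
  "len C = (if length C = 1 then lv (hd C) else lv (hd C) - 1)"

function vnode :: "nat list \<Rightarrow> nd list" where
  "vnode C = map (\<lambda>p. if blk p < hd C then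
       (if p = lv (blk p) then Nd (payload n pv (blk p # C)) (vnode (blk p # C))
        else if length C \<le> n \<and> p = base (blk p) + kk (blk p) (sig pv (blk p) C) then Nd 1 [] else Nd 0 [])
     else Nd 0 []) [0..<len C]"
  by pat_completeness auto
termination by (relation "measure hd") auto

declare vnode.simps [simp del]

lemma length_vnode [simp]: "length (vnode C) = len C"
  by (simp add: vnode.simps)

lemma nth_vnode: "p < len C \<Longrightarrow> vnode C ! p = (if blk p < hd C then
       (if p = lv (blk p) then Nd (payload n pv (blk p # C)) (vnode (blk p # C))
        else if length C \<le> n \<and> p = base (blk p) + kk (blk p) (sig pv (blk p) C) then Nd 1 [] else Nd 0 [])
     else Nd 0 [])"
  by (subst vnode.simps) simp

lemma lv_len: "C \<noteq> [] \<Longrightarrow> lv j < len C \<longleftrightarrow> j < hd C"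
proof
  assume "j < hd C"
  then have "Suc (lv j) < lv (hd C)" using lv_base[of j "hd C"] base_K[of "hd C"] by linarith
  then show "lv j < len C" by (auto simp: len_def)
next
  assume "lv j < len C"
  then have "lv j < lv (hd C)" by (auto simp: len_def split: if_splits)
  then show "j < hd C" using lv_strict by (simp add: strict_mono_less)
qed

lemma nth_vnode_lv: "j < hd C \<Longrightarrow> C \<noteq> [] \<Longrightarrow> vnode C ! lv j = Nd (payload n pv (j # C)) (vnode (j # C))"
  using lv_len[of C j] by (simp add: nth_vnode)

lemma chain_Cons: "sorted_wrt (<) C \<Longrightarrow> C \<noteq> [] \<Longrightarrow> j < hd C \<Longrightarrow> chain j C"
  unfolding chain_def by (cases C) auto

lemma vnode_in_T: "sorted_wrt (<) C \<Longrightarrow> C \<noteq> [] \<Longrightarrow> vnode C \<in> T"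
proof (induction "hd C" arbitrary: C rule: less_induct)
  case less
  have "okl p (vnode C ! p)" if p: "p < length (vnode C)" for p
  proof -
    have pl: "p < len C" using p by simp
    show ?thesis
    proof (cases "blk p < hd C \<and> p = lv (blk p)")
      case True
      let ?j = "blk p"
      have ch: "chain ?j C" using chain_Cons less.prems True by blast
      then have "sorted_wrt (<) (?j # C)" by (simp add: chain_def)
      then have "vnode (?j # C) \<in> T" using less.hyps[of "?j # C"] True by simp
      moreover have "payload n pv (?j # C) \<le> p" using lv_payload[OF ch] True by simp
      moreover have "len (?j # C) \<le> p - 1" using less.prems True by (simp add: len_def)
      ultimately show ?thesis using True pl by (simp add: nth_vnode okl_def)
    next
      case False
      have "p \<ge> 1" if "p = base (blk p) + k" for k using base_pos[of "blk p"] that by linarith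
      then show ?thesis using False pl by (auto simp: nth_vnode okl_def)
    qed
  qed
  then show ?case by (simp add: T_iff)
qed

text \<open>Induction on \<open>j\<close>: towards smaller vertices, the signature of
  \<open>j # C\<close> is determined by that of \<open>C\<close>.\<close>

lemma vnode_sig: "sig pv j C = sig pv j C' \<Longrightarrow> C \<noteq> [] \<Longrightarrow> C' \<noteq> [] \<Longrightarrow> vnode (j # C) = vnode (j # C')"
proof (induction j arbitrary: C C' rule: less_induct)
  case (less j)
  have L: "length C = length C'" using sig_length less.prems by blast
  have ln: "len (j # C) = len (j # C')" using less.prems by (simp add: len_def)
  show ?case
  proof (rule nth_equalityI)
    fix p assume "p < length (vnode (j # C))"
    then have p: "p < len (j # C)" "p < len (j # C')" using ln by auto
    show "vnode (j # C) ! p = vnode (j # C') ! p"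
    proof (cases "blk p < j")
      case True
      have s: "sig pv (blk p) (j # C) = sig pv (blk p) (j # C')" using sig_Cons[OF less.prems(1) True] .
      have "payload n pv (blk p # j # C) = payload n pv (blk p # j # C')" using sig_payload[OF s] .
      moreover have "vnode (blk p # j # C) = vnode (blk p # j # C')" using less.IH[OF True s] by simp
      ultimately show ?thesis using p s L by (simp add: nth_vnode)
    next
      case False then show ?thesis using p by (simp add: nth_vnode)
    qed
  qed (simp add: ln)
qed

text \<open>The announcement for \<open>j\<close> lies below \<open>lv j\<close>, so it belongs to
  the common prefix; \<open>kk_inj\<close> turns equal announcements into equal signatures.\<close>

lemma well_split:
  assumes C: "sorted_wrt (<) C" "C \<noteq> []" "length C \<le> n" "j < hd C"
    and C': "sorted_wrt (<) C'" "C' \<noteq> []" "length C' \<le> n" "j < hd C'"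
    and eq: "take (lv j) (vnode C) = take (lv j) (vnode C')"
  shows "vnode C ! lv j = vnode C' ! lv j"
proof -
  have ch: "chain j C" "chain j C'" using chain_Cons C C' by auto
  let ?p = "base j + kk j (sig pv j C)"
  have p: "?p < lv j" using kk_less[OF ch(1) C(3)] base_K[of j] by linarith
  have b: "blk ?p = j" using p by (intro blk_eq) auto
  have "?p < len C" "?p < len C'" using p lv_len[of C j] lv_len[of C' j] C C' by auto
  moreover have "vnode C ! ?p = vnode C' ! ?p" using eq p by (metis nth_take)
  moreover have "?p \<noteq> lv j" using p by simp
  ultimately have "kk j (sig pv j C) = kk j (sig pv j C')"
    using b C C' by (simp add: nth_vnode split: if_splits)
  then have s: "sig pv j C = sig pv j C'" using kk_inj[OF ch(1) C(3) ch(2) C'(3)] by simp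
  show ?thesis using nth_vnode_lv C C' sig_payload[OF s] vnode_sig[OF s] by simp
qed

fun pays :: "nat list \<Rightarrow> nat list \<Rightarrow> nat list" where
  "pays C [] = []"
| "pays C (j # js) = payload n pv (j # C) # pays (j # C) js"

lemma rd_vnode: "C \<noteq> [] \<Longrightarrow> sorted_wrt (>) (hd C # js) \<Longrightarrow> rd (vnode C) (map lv js) = pays C js \<and> okp (vnode C) (map lv js)"
proof (induction js arbitrary: C)
  case Nil then show ?case by simp
next
  case (Cons j js)
  have "j < hd C" using Cons.prems by simp
  then show ?case using Cons.IH[of "j # C"] Cons.prems lv_len[of C j] by (auto simp: nth_vnode_lv)
qed

lemma length_pays [simp]: "length (pays C js) = length js"
  by (induction js arbitrary: C) auto

lemma nth_pays: "q < length js \<Longrightarrow> pays C js ! q = payload n pv (rev (take (Suc q) js) @ C)"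
proof (induction js arbitrary: C q)
  case (Cons j js)
  then show ?case by (cases q) auto
qed simp

text \<open>Beyond \<open>n\<close>, \<open>Cn\<close> consists of the \<open>n + 1\<close> largest
  vertices. The stored representative may differ from \<open>Cn\<close>, but the remaining vertices
  lie below \<open>hd Cn\<close>, and with those both give the same patterns.\<close>

lemma dec_pays:
  assumes "sorted_wrt (>) (i # js)" "js \<noteq> []"
  shows "dec n pv (Suc (length js)) (pays [i] js) = pv (set (i # js))"
proof (cases "Suc (length js) \<le> n")
  case True
  have "pays [i] js \<noteq> []" using assms(2) by (cases js) auto
  then have "last (pays [i] js) = pays [i] js ! (length js - 1)" by (simp add: last_conv_nth)
  also have "\<dots> = payload n pv (rev js @ [i])" using assms(2) by (subst nth_pays) auto
  finally show ?thesis using True by (simp add: dec_def payload_def insert_commute)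
next
  case False
  then have nl: "n \<le> length js" by simp
  define Cn where "Cn = rev (take n js) @ [i]"
  have lenC: "length Cn = Suc n" using nl by (simp add: Cn_def)
  have "pays [i] js ! (n - 1) = payload n pv (rev (take (Suc (n - 1)) js) @ [i])"
    by (rule nth_pays) (use nl n_pos in linarith)
  then have p1: "pays [i] js ! (n - 1) = to_nat (SOME C'. same_table pv Cn C')"
    using n_pos lenC by (simp add: payload_def Cn_def)
  have st: "same_table pv Cn (SOME C'. same_table pv Cn C')"
    by (rule someI[of _ Cn]) (simp add: same_table_def)
  have p2: "drop n (pays [i] js) = drop n js"
  proof (rule nth_equalityI)
    fix q assume "q < length (drop n (pays [i] js))"
    then have q: "n + q < length js" by simp
    have "drop n (pays [i] js) ! q = payload n pv (rev (take (Suc (n + q)) js) @ [i])"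
      using q nth_pays[OF q] by simp
    also have "\<dots> = js ! (n + q)" using q by (simp add: payload_def take_Suc_conv_app_nth)
    finally show "drop n (pays [i] js) ! q = drop n js ! q" using q by simp
  qed simp
  have hdC: "hd Cn = js ! (n - 1)"
    using nl n_pos by (cases n) (auto simp: Cn_def take_Suc_conv_app_nth)
  have "set (drop n js) \<subseteq> {..<hd Cn}"
  proof
    fix x assume "x \<in> set (drop n js)"
    then obtain q where "q < length js - n" "x = drop n js ! q" by (metis in_set_conv_nth length_drop)
    then have q: "n + q < length js" "x = js ! (n + q)" by auto
    then have "js ! (n - 1) > js ! (n + q)" using assms(1) n_pos by (intro sorted_wrt_nth_less[of "(>)" js]) auto
    then show "x \<in> {..<hd Cn}" using q hdC by simp
  qed
  then have "pv (set (SOME C'. same_table pv Cn C') \<union> set (drop n js)) = pv (set Cn \<union> set (drop n js))"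
    using st unfolding same_table_def by blast
  also have "set Cn \<union> set (drop n js) = set (i # js)"
  proof -
    have "set (take n js) \<union> set (drop n js) = set js" by (metis append_take_drop_id set_append)
    then show ?thesis unfolding Cn_def by auto
  qed
  finally show ?thesis using False by (simp add: dec_def p1[simplified] p2)
qed

lemma rd_copy_vnode:
  assumes c: "copy m \<phi>" and "sorted_wrt (>) (i # js)" "js \<noteq> []"
  shows "dec n pv (Suc (length js)) (rd (\<phi> (vnode [i])) (map (\<lambda>j. length (\<phi> (vnode [j]))) js)) = pv (set (i # js))"
proof -
  have len: "length (\<phi> (vnode [j])) = m (lv j)" for j
    using copy_length[OF c vnode_in_T[of "[j]"]] by (simp add: len_def)
  have r: "rd (vnode [i]) (map lv js) = pays [i] js \<and> okp (vnode [i]) (map lv js)" using rd_vnode[of "[i]" js] assms(2) by simp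
  have e: "map (\<lambda>j. length (\<phi> (vnode [j]))) js = map m (map lv js)" by (simp add: len)
  have "rd (\<phi> (vnode [i])) (map (\<lambda>j. length (\<phi> (vnode [j]))) js) = pays [i] js"
    unfolding e using rd_copy[OF c vnode_in_T[of "[i]"], of "map lv js"] r by simp
  then show ?thesis using dec_pays[OF assms(2,3)] by simp
qed

text \<open>All nonempty subsets of \<open>I\<close> are needed to contain the subnodes found at
  coding levels of vertices of \<open>I\<close>.\<close>

definition conf :: "nat set \<Rightarrow> nd list set" where
  "conf I = insert [] ((\<lambda>S. vnode (sorted_list_of_set S)) ` (Pow I - {{}}))"

lemma conf_cases:
  assumes "finite I" "x \<in> conf I"
  shows "x = [] \<or> (\<exists>C. x = vnode C \<and> sorted_wrt (<) C \<and> C \<noteq> [] \<and> set C \<subseteq> I \<and> length C \<le> card I)"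
proof (cases "x = []")
  case False
  then obtain S where S: "S \<subseteq> I" "S \<noteq> {}" "x = vnode (sorted_list_of_set S)" using assms(2) by (auto simp: conf_def)
  have "finite S" using S assms finite_subset by blast
  moreover from this have "card S \<le> card I" using S(1) assms(1) card_mono by blast
  ultimately show ?thesis using S by (intro disjI2 exI[of _ "sorted_list_of_set S"]) auto
qed simp

lemma vnode_in_conf:
  assumes "sorted_wrt (<) C" "C \<noteq> []" "set C \<subseteq> I" shows "vnode C \<in> conf I"
proof -
  have "sorted C" "distinct C" using assms(1) by (auto simp: strict_sorted_iff)
  then have "sorted_list_of_set (set C) = C" by (simp add: sorted_list_of_set.idem_if_sorted_distinct)
  then show ?thesis unfolding conf_def using assms by (intro insertI2 image_eqI[of _ _ "set C"]) auto
qed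

text \<open>The coding level of a vertex outside \<open>I\<close> is not relevant: no node ends
  there, and \<open>well_split\<close> excludes splitting. At coding levels of \<open>I\<close> the
  chain stays inside \<open>I\<close>, so the payload is a pattern on at most \<open>n\<close>
  vertices. Other levels carry \<open>Nd 0 []\<close> or \<open>Nd 1 []\<close>, whence
  \<open>b \<ge> 2\<close>.\<close>

lemma conf_type:
  assumes I: "finite I" "card I \<le> n" and b: "b \<ge> 2" "\<And>J. finite J \<Longrightarrow> card J \<le> n \<Longrightarrow> pv J < b"
  shows "\<exists>\<tau>\<in>types (Suc (2 ^ n)) b. \<exists>ds as. (ds, as) \<in> reachable \<tau> \<and> (\<forall>i\<in>I. vnode [i] \<in> set ds) \<and> length ds \<le> ds_bound (Suc (2 ^ n))"
proof -
  let ?X = "conf I"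
  have fin: "finite ?X" using I by (simp add: conf_def)
  have "card ?X \<le> Suc (card ((\<lambda>S. vnode (sorted_list_of_set S)) ` (Pow I - {{}})))"
    unfolding conf_def by (rule card_insert_le_m1) auto
  also have "card ((\<lambda>S. vnode (sorted_list_of_set S)) ` (Pow I - {{}})) \<le> card (Pow I)"
    using I by (intro order_trans[OF card_image_le] card_mono) auto
  also have "card (Pow I) \<le> 2 ^ n" using I by (simp add: card_Pow power_increasing)
  finally have card: "card ?X \<le> Suc (2 ^ n)" by simp
  have XT: "?X \<subseteq> T"
  proof
    fix x assume "x \<in> ?X"
    then show "x \<in> T" using conf_cases[OF I(1)] vnode_in_T by fastforce
  qed
  have "pay (x ! p) < b \<and> (sub (x ! p) = [] \<or> sub (x ! p) \<in> ?X)"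
    if x: "x \<in> ?X" and p: "p < length x" and pr: "p \<in> rlevels ?X" for x p
  proof -
    obtain C where C: "x = vnode C" "sorted_wrt (<) C" "C \<noteq> []" "set C \<subseteq> I" "length C \<le> n"
      using conf_cases[OF I(1) x] p I(2) by auto
    have pl: "p < len C" using p C by simp
    show ?thesis
    proof (cases "blk p < hd C \<and> p = lv (blk p)")
      case False
      then show ?thesis using pl C(1) b(1) by (auto simp: nth_vnode)
    next
      case True
      define j where "j = blk p"
      have j: "j < hd C" "p = lv j" using True by (auto simp: j_def)
      have ch: "sorted_wrt (<) (j # C)" using chain_Cons[OF C(2,3) j(1)] by (simp add: chain_def)
      have xp: "x ! p = Nd (payload n pv (j # C)) (vnode (j # C))" using nth_vnode_lv[OF j(1) C(3)] C(1) j by simp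
      have "j \<in> I"
      proof (rule ccontr)
        assume jI: "j \<notin> I"
        have "p \<noteq> 0" using base_K[of j] j by simp
        moreover have "length x' \<noteq> p" if x': "x' \<in> ?X" for x'
        proof
          assume l: "length x' = p"
          then obtain C' where C': "x' = vnode C'" "C' \<noteq> []" "set C' \<subseteq> I" using conf_cases[OF I(1) x'] \<open>p \<noteq> 0\<close> by auto
          then have h: "hd C' \<in> I" by (auto simp: hd_in_set subset_iff)
          have e: "len C' = lv j" using l C' j by simp
          show False
          proof (cases "length C' = 1")
            case True then have "hd C' = j" using e lv_strict by (simp add: len_def strict_mono_eq)
            then show False using h jI by simp
          next
            case False
            \<comment> \<open>A node of a longer chain ends just below a coding level, and the gap
              in \<open>base_K\<close> keeps the other coding levels away from there.\<close>
            then have e': "lv (hd C') - 1 = lv j" using e by (simp add: len_def)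
            have "lv j < lv (hd C')" using e' base_K[of "hd C'"] by linarith
            then have "j < hd C'" using lv_strict by (simp add: strict_mono_less)
            then show False using lv_base[of j "hd C'"] base_K[of "hd C'"] e' by linarith
          qed
        qed
        moreover have "x1 ! p = x2 ! p"
          if xx: "x1 \<in> ?X" "x2 \<in> ?X" "p < length x1" "p < length x2" "take p x1 = take p x2" for x1 x2
        proof -
          obtain C1 where C1: "x1 = vnode C1" "sorted_wrt (<) C1" "C1 \<noteq> []" "length C1 \<le> n"
            using conf_cases[OF I(1) xx(1)] xx(3) I(2) by auto
          obtain C2 where C2: "x2 = vnode C2" "sorted_wrt (<) C2" "C2 \<noteq> []" "length C2 \<le> n"
            using conf_cases[OF I(1) xx(2)] xx(4) I(2) by auto
          have "j < hd C1" "j < hd C2" using xx C1 C2 j lv_len[of C1 j] lv_len[of C2 j] by auto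
          then show ?thesis using well_split[of C1 j C2] C1 C2 xx j by simp
        qed
        ultimately show False using pr unfolding rlevels_def by blast
      qed
      then have sI: "set (j # C) \<subseteq> I" using C by auto
      then have "vnode (j # C) \<in> ?X" using ch by (intro vnode_in_conf) auto
      moreover have "payload n pv (j # C) < b"
      proof -
        have "distinct (j # C)" using ch by (simp only: strict_sorted_iff)
        then have "length (j # C) = card (set (j # C))" by (simp only: distinct_card)
        also have "\<dots> \<le> n" using card_mono[OF I(1) sI] I(2) by simp
        finally have "length (j # C) \<le> n" .
        then have "payload n pv (j # C) = pv (set (j # C))" by (simp add: payload_def)
        moreover have "card (set (j # C)) \<le> n" using card_mono[OF I(1) sI] I(2) by simp
        ultimately show ?thesis using b(2)[of "set (j # C)"] by simp
      qed
      ultimately show ?thesis using xp by simp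
    qed
  qed
  from configuration_type[OF fin XT _ card, of b, OF _ this] obtain \<tau> ds as where
    "\<tau> \<in> types (Suc (2 ^ n)) b" "(ds, as) \<in> reachable \<tau>" "?X \<subseteq> set ds" "length ds \<le> ds_bound (Suc (2 ^ n))"
    by (auto simp: conf_def)
  moreover have "vnode [i] \<in> ?X" if "i \<in> I" for i using that by (intro vnode_in_conf) auto
  ultimately show ?thesis by blast
qed

end

text \<open>The levels are chosen recursively above the payload bounds, with room for the
  announcements. \<open>Z\<close> is a further lower bound that later makes the numbering of coded
  vertices increasing.\<close>

lemma coded_exists:
  fixes pv :: "nat set \<Rightarrow> nat" and Z :: "nat \<Rightarrow> nat \<Rightarrow> nat"
  assumes fin: "\<And>k. finite (pv ` {J. finite J \<and> card J = k})" and n: "n \<ge> 1"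
  shows "\<exists>lv kk K. coded n pv lv kk K \<and> (\<forall>j. Z j (lv j) \<le> lv (Suc j))"
proof -
  let ?S = "\<lambda>j. sig pv j ` {C. chain j C \<and> length C \<le> n}"
  define kk where "kk j = to_nat_on (?S j)" for j
  define K where "K j = Suc (Max (insert 0 (kk j ` ?S j)))" for j
  obtain b where b: "\<And>j C. chain j C \<Longrightarrow> payload n pv (j # C) \<le> b j"
    using payload_bounded[OF fin, of _ n] by metis
  define lv where "lv = rec_nat (2 + K 0 + b 0) (\<lambda>j r. r + K (Suc j) + b (Suc j) + Z j r + 2)"
  have lv0: "lv 0 = 2 + K 0 + b 0" and lvS: "\<And>j. lv (Suc j) = lv j + K (Suc j) + b (Suc j) + Z j (lv j) + 2"
    by (auto simp: lv_def)
  have bl: "b j \<le> lv j" for j by (cases j) (auto simp: lv0 lvS)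
  have "coded n pv lv kk K"
  proof
    fix j C assume "chain j C" "length C \<le> n"
    then have "kk j (sig pv j C) \<le> Max (insert 0 (kk j ` ?S j))"
      using finite_sig[OF fin] by (intro Max_ge) auto
    then show "kk j (sig pv j C) < K j" by (simp add: K_def)
  next
    fix j C C' assume "chain j C" "length C \<le> n" "chain j C'" "length C' \<le> n" "kk j (sig pv j C) = kk j (sig pv j C')"
    moreover have "inj_on (kk j) (?S j)" unfolding kk_def using finite_sig[OF fin] by (intro inj_on_to_nat_on countable_finite)
    ultimately show "sig pv j C = sig pv j C'" unfolding inj_on_def by blast
  next
    fix j C assume "chain j C"
    then show "payload n pv (j # C) \<le> lv j" using b[of j C] bl[of j] by linarith
  qed (use n in \<open>auto simp: lv0 lvS\<close>)
  then show ?thesis using lvS by (intro exI[of _ lv] exI[of _ kk] exI[of _ K]) auto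
qed

section \<open>The universal structure carried by the tree\<close>

instance nd :: countable by countable_datatype

section \<open>Patterns of H as numbers\<close>

lemma sorted_list_of_set_strict_mono_image:
  fixes h :: "nat \<Rightarrow> nat"
  assumes "finite S" "strict_mono_on S h"
  shows "sorted_list_of_set (h ` S) = map h (sorted_list_of_set S)"
proof -
  let ?L = "sorted_list_of_set S"
  have "sorted_wrt (<) ?L" by simp
  then have "sorted_wrt (\<lambda>x y. h x < h y) ?L"
    by (rule sorted_wrt_mono_rel[rotated]) (use assms in \<open>auto simp: strict_mono_on_def\<close>)
  then have "sorted_wrt (<) (map h ?L)" by (simp add: sorted_wrt_map)
  then have "sorted_list_of_set (set (map h ?L)) = map h ?L"
    by (intro sorted_list_of_set.idem_if_sorted_distinct) (auto simp: strict_sorted_iff)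
  then show ?thesis using assms(1) by simp
qed

text \<open>Entries are ranks in \<open>J\<close>. When all relations are injective, a related tuple
  has as many vertices as its arity, so arity \<open>card J\<close> suffices: the tuple is recorded
  at its own vertex set.\<close>

definition pattern :: "('r \<Rightarrow> nat) \<Rightarrow> 'r struct \<Rightarrow> nat set \<Rightarrow> ('r \<times> nat list) set" where
  "pattern ar H J = {(R, is). ar R = card J \<and> length is = card J \<and> set is \<subseteq> {..<card J} \<and>
     map (\<lambda>i. sorted_list_of_set J ! i) is \<in> rels H R}"

text \<open>Singletons get no information here: their unary relations, possibly infinitely many, are
  handled by tags.\<close>

definition pnum :: "('r \<Rightarrow> nat) \<Rightarrow> 'r struct \<Rightarrow> nat set \<Rightarrow> nat" where
  "pnum ar H J = (if card J \<ge> 2 then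
     to_nat_on (Pow ({R. ar R = card J} \<times> {is. set is \<subseteq> {..<card J} \<and> length is = card J})) (pattern ar H J) else 0)"

lemma pattern_space:
  assumes "\<forall>k \<ge> 2. finite {R. ar R = k}" "k \<ge> 2"
  shows "finite (Pow ({R. ar R = k} \<times> {is. set is \<subseteq> {..<k} \<and> length is = k}))"
  using assms by (simp add: finite_lists_length_eq)

lemma pattern_in_space:
  "card J = k \<Longrightarrow> pattern ar H J \<in> Pow ({R. ar R = k} \<times> {is. set is \<subseteq> {..<k} \<and> length is = k})"
  by (auto simp: pattern_def)

lemma finite_pnum:
  assumes "\<forall>k \<ge> 2. finite {R. ar R = k}"
  shows "finite (pnum ar H ` {J. finite J \<and> card J = k})"
proof (cases "k \<ge> 2")
  case True
  let ?P = "Pow ({R. ar R = k} \<times> {is. set is \<subseteq> {..<k} \<and> length is = k})"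
  have "pnum ar H ` {J. finite J \<and> card J = k} \<subseteq> to_nat_on ?P ` ?P"
  proof
    fix v assume "v \<in> pnum ar H ` {J. finite J \<and> card J = k}"
    then obtain J where J: "card J = k" "v = pnum ar H J" by auto
    then have "v = to_nat_on ?P (pattern ar H J)" using True by (simp add: pnum_def)
    then show "v \<in> to_nat_on ?P ` ?P" using pattern_in_space[OF J(1), of ar H] by blast
  qed
  then show ?thesis by (rule finite_surj[OF pattern_space[OF assms True]])
next
  case False
  then have "pnum ar H ` {J. finite J \<and> card J = k} \<subseteq> {0}" by (auto simp: pnum_def)
  then show ?thesis by (rule finite_subset) simp
qed

text \<open>Strictly monotone maps preserve ranks, so equal patterns of the two images relate
  corresponding tuples in the same way.\<close>

lemma pnum_transfer:
  fixes h h' :: "nat \<Rightarrow> nat"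
  assumes fin: "\<forall>k \<ge> 2. finite {R. ar R = k}"
    and S: "finite S" "strict_mono_on S h" "strict_mono_on S h'" "pnum ar H (h ` S) = pnum ar H (h' ` S)"
    and u: "set u = S" "length u = ar R" "card S = ar R" "ar R \<ge> 2"
    and m: "map h u \<in> rels H R"
  shows "map h' u \<in> rels H R"
proof -
  let ?L = "sorted_list_of_set S" and ?k = "ar R"
  have inj: "inj_on h S" "inj_on h' S" using S(2,3) by (auto simp: strict_mono_on_imp_inj_on)
  have c: "card (h ` S) = ?k" "card (h' ` S) = ?k" using inj u(3) by (auto simp: card_image)
  have "\<forall>x\<in>set u. \<exists>i<?k. ?L ! i = x"
  proof
    fix x assume "x \<in> set u"
    then have "x \<in> set ?L" using u(1) S(1) by simp
    then obtain i where "i < length ?L" "?L ! i = x" by (auto simp: in_set_conv_nth)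
    then show "\<exists>i<?k. ?L ! i = x" using u(3) by auto
  qed
  then obtain ix where ix: "\<And>x. x \<in> set u \<Longrightarrow> ix x < ?k \<and> ?L ! ix x = x" by metis
  have len: "length ?L = ?k" using u(3) by simp
  have ev: "map (\<lambda>i. map g ?L ! i) (map ix u) = map g u" for g :: "nat \<Rightarrow> nat"
    using ix len by simp
  have slh: "sorted_list_of_set (h ` S) = map h ?L" "sorted_list_of_set (h' ` S) = map h' ?L"
    using sorted_list_of_set_strict_mono_image S by auto
  have "(R, map ix u) \<in> pattern ar H (h ` S)"
    unfolding pattern_def using c u(2) ix m by (simp only: slh ev mem_Collect_eq split_conv) auto
  moreover have "pattern ar H (h ` S) = pattern ar H (h' ` S)"
  proof -
    let ?P = "Pow ({R. ar R = ?k} \<times> {is. set is \<subseteq> {..<?k} \<and> length is = ?k})"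
    have "inj_on (to_nat_on ?P) ?P" using pattern_space[OF fin u(4)] by (intro inj_on_to_nat_on countable_finite)
    moreover have "to_nat_on ?P (pattern ar H (h ` S)) = to_nat_on ?P (pattern ar H (h' ` S))"
      using S(4) c u(4) by (simp add: pnum_def)
    ultimately show ?thesis using pattern_in_space[OF c(1), of ar H] pattern_in_space[OF c(2), of ar H] by (rule inj_onD)
  qed
  ultimately have "(R, map ix u) \<in> pattern ar H (h' ` S)" by simp
  then have "map (\<lambda>i. sorted_list_of_set (h' ` S) ! i) (map ix u) \<in> rels H R"
    unfolding pattern_def by blast
  then show ?thesis unfolding slh ev .
qed

text \<open>A vertex of the tree structure is the number of a pair: a node, and as its tag a vertex
  of \<open>H\<close> whose unary relations it shall have.\<close>

definition node :: "nat \<Rightarrow> nd list" where "node z = fst (from_nat z :: nd list \<times> nat)"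
definition tag :: "nat \<Rightarrow> nat" where "tag z = snd (from_nat z :: nd list \<times> nat)"
definition lev :: "nat \<Rightarrow> nat" where "lev z = length (node z)"

lemma node_to_nat [simp]: "node (to_nat (x :: nd list, t :: nat)) = x"
  and tag_to_nat [simp]: "tag (to_nat (x :: nd list, t :: nat)) = t"
  by (simp_all add: node_def tag_def)

text \<open>The pattern number that the nodes claim for \<open>S\<close>, found by reading the
  largest vertex along the levels of the others. Claims for different sets may be inconsistent with
  \<open>H\<close>.\<close>

definition cval :: "nat \<Rightarrow> ('r \<Rightarrow> nat) \<Rightarrow> 'r struct \<Rightarrow> nat set \<Rightarrow> nat" where
  "cval n ar H S = (let zs = rev (sorted_list_of_set S) in
     dec n (pnum ar H) (card S) (rd (node (hd zs)) (map lev (tl zs))))"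

definition same_unary :: "('r \<Rightarrow> nat) \<Rightarrow> 'r struct \<Rightarrow> nat \<Rightarrow> nat \<Rightarrow> bool" where
  "same_unary ar H i j \<longleftrightarrow> (\<forall>R. ar R = 1 \<longrightarrow> ([i] \<in> rels H R \<longleftrightarrow> [j] \<in> rels H R))"

text \<open>
  Every finite set S of tree vertices prescribes patterns for its subsets. These are realised in
  the tree structure only if some increasing map h into H realises all of them at once; this makes
  the tree structure free of whatever H is free of.
\<close>

definition good :: "nat \<Rightarrow> ('r \<Rightarrow> nat) \<Rightarrow> 'r struct \<Rightarrow> nat set \<Rightarrow> (nat \<Rightarrow> nat) \<Rightarrow> bool" where
  "good n ar H S h \<longleftrightarrow> finite S \<and> strict_mono_on S lev \<and> strict_mono_on S h \<and>
     (\<forall>z\<in>S. same_unary ar H (h z) (tag z)) \<and>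
     (\<forall>S'\<subseteq>S. card S' \<ge> 2 \<longrightarrow> cval n ar H S' = pnum ar H (h ` S'))"

definition tree_struct :: "nat \<Rightarrow> ('r \<Rightarrow> nat) \<Rightarrow> 'r struct \<Rightarrow> 'r struct" where
  "tree_struct n ar H = (UNIV, \<lambda>R. {t. length t = ar R \<and> (\<exists>h. good n ar H (set t) h \<and> map h t \<in> rels H R)})"

lemma good_subset: "good n ar H S h \<Longrightarrow> S' \<subseteq> S \<Longrightarrow> good n ar H S' h"
  unfolding good_def by (auto intro: finite_subset simp: strict_mono_on_def subset_iff)

text \<open>The choice of the witness does not matter: tags fix the unary relations, and by
  injectivity the tuple has \<open>ar R\<close> distinct vertices, so \<open>cval\<close> fixes its
  pattern.\<close>

lemma good_transfer:
  assumes ar: "\<forall>R. ar R \<ge> 1" and fin: "\<forall>k \<ge> 2. finite {R. ar R = k}" and inj: "\<forall>R. injective_rel H R"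
    and h: "good n ar H (set u) h" and h': "good n ar H (set u) h'"
    and u: "length u = ar R" "map h u \<in> rels H R"
  shows "map h' u \<in> rels H R"
proof (cases "ar R = 1")
  case True
  then obtain z where z: "u = [z]" using u(1) by (auto simp: length_Suc_conv)
  have "same_unary ar H (h z) (tag z)" "same_unary ar H (h' z) (tag z)" using h h' z by (auto simp: good_def)
  then show ?thesis using u(2) z True by (simp add: same_unary_def)
next
  case False
  moreover have "ar R \<ge> 1" using ar by blast
  ultimately have k: "ar R \<ge> 2" by linarith
  have "distinct (map h u)" using inj u(2) by (auto simp: injective_rel_def)
  then have "distinct u" by (simp add: distinct_map)
  then have c: "card (set u) = ar R" using u(1) by (simp add: distinct_card)
  have "cval n ar H (set u) = pnum ar H (h ` set u)" "cval n ar H (set u) = pnum ar H (h' ` set u)"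
    using h h' c k unfolding good_def by auto
  then have "pnum ar H (h ` set u) = pnum ar H (h' ` set u)" by simp
  then show ?thesis
    using pnum_transfer[OF fin _ _ _ _ refl u(1) c k u(2), of h'] h h' unfolding good_def by blast
qed

text \<open>One tuple covers \<open>F\<close>, and since its image is related there is one good
  \<open>h\<close> on the whole image of \<open>F\<close>. By \<open>good_transfer\<close> it
  decides all other tuples, so \<open>F\<close> would embed into \<open>H\<close>.\<close>

lemma tree_struct_free:
  assumes ar: "\<forall>R. ar R \<ge> 1" and fin: "\<forall>k \<ge> 2. finite {R. ar R = k}" and inj: "\<forall>R. injective_rel H R"
    and H: "verts H = UNIV" and F: "\<forall>F \<in> \<F>. finite_struct ar F \<and> covered_by_relation F" and free: "free_of ar \<F> H"
  shows "free_of ar \<F> (tree_struct n ar H)"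
  unfolding free_of_def
proof (intro ballI equals0I)
  fix F f assume FF: "F \<in> \<F>" and "f \<in> embs ar F (tree_struct n ar H)"
  then have f: "inj_on f (verts F)" "mono_on (verts F) f"
    "\<And>R t. length t = ar R \<Longrightarrow> set t \<subseteq> verts F \<Longrightarrow> t \<in> rels F R \<longleftrightarrow> map f t \<in> rels (tree_struct n ar H) R"
    by (auto simp: embs_def is_emb_def)
  obtain R0 t0 where t0: "t0 \<in> rels F R0" "set t0 = verts F" using F FF by (auto simp: covered_by_relation_def)
  have "length t0 = ar R0" using F FF t0(1) by (auto simp: finite_struct_def wf_struct_def)
  then have "map f t0 \<in> rels (tree_struct n ar H) R0" using f(3) t0 by blast
  then obtain h where h: "good n ar H (f ` verts F) h" using t0(2) by (auto simp: tree_struct_def)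
  have sm: "strict_mono_on (f ` verts F) h" using h by (simp add: good_def)
  then have hinj: "inj_on h (f ` verts F)" by (rule strict_mono_on_imp_inj_on)
  let ?e = "restrict (h \<circ> f) (verts F)"
  have "is_emb ar F H ?e"
    unfolding is_emb_def
  proof (intro conjI allI impI)
    show "inj_on ?e (verts F)" using comp_inj_on[OF f(1) hinj] by (simp add: inj_on_restrict_eq)
    show "mono_on (verts F) ?e"
    proof (rule mono_onI)
      fix r s assume rs: "r \<in> verts F" "s \<in> verts F" "r \<le> s"
      then have "f r \<le> f s" using f(2) by (auto simp: mono_on_def)
      then have "h (f r) \<le> h (f s)" using sm rs by (metis imageI le_less strict_mono_onD)
      then show "?e r \<le> ?e s" using rs by simp
    qed
  next
    fix R t assume t: "length t = ar R \<and> set t \<subseteq> verts F"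
    then have me: "map ?e t = map h (map f t)" by auto
    have g: "good n ar H (set (map f t)) h" by (rule good_subset[OF h]) (use t in auto)
    have "t \<in> rels F R \<longleftrightarrow> map f t \<in> rels (tree_struct n ar H) R" using f(3) t by blast
    also have "\<dots> \<longleftrightarrow> map h (map f t) \<in> rels H R"
    proof
      assume "map f t \<in> rels (tree_struct n ar H) R"
      then obtain h' where "good n ar H (set (map f t)) h'" "map h' (map f t) \<in> rels H R"
        unfolding tree_struct_def snd_conv by blast
      then show "map h (map f t) \<in> rels H R" using good_transfer[OF ar fin inj _ g] t by (metis length_map)
    next
      assume "map h (map f t) \<in> rels H R"
      then show "map f t \<in> rels (tree_struct n ar H) R"
        unfolding tree_struct_def snd_conv using g t by (metis (mono_tags, lifting) length_map mem_Collect_eq)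
    qed
    finally show "t \<in> rels F R \<longleftrightarrow> map ?e t \<in> rels H R" unfolding me .
  qed (use H in auto)
  then show False using free FF by (auto simp: free_of_def embs_def)
qed

lemma wf_tree_struct: "wf_struct ar (tree_struct n ar H)"
  by (simp add: wf_struct_def tree_struct_def)

text \<open>Every forbidden structure contains a tuple, so the infinite structure without relations
  is free and embeds into \<open>H\<close>.\<close>

lemma universal_infinite:
  fixes H :: "'r struct"
  assumes "wf_struct ar H" and F: "\<forall>F \<in> \<F>. finite_struct ar F \<and> covered_by_relation F"
    and univ: "\<forall>A. wf_struct ar A \<and> free_of ar \<F> A \<longrightarrow> embs ar A H \<noteq> {}"
  shows "verts H = UNIV"
proof -
  let ?E = "(UNIV, \<lambda>_. {}) :: 'r struct"
  have "free_of ar \<F> ?E"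
    unfolding free_of_def
  proof (intro ballI equals0I)
    fix F f assume "F \<in> \<F>" and f: "f \<in> embs ar F ?E"
    then have wfF: "wf_struct ar F" and "covered_by_relation F" using F by (auto simp: finite_struct_def)
    then obtain R t where t: "t \<in> rels F R" unfolding covered_by_relation_def by blast
    then have t': "length t = ar R" "set t \<subseteq> verts F" using wfF by (auto simp: wf_struct_def)
    have "t \<in> rels F R \<longleftrightarrow> map f t \<in> rels ?E R" using f t' unfolding embs_def is_emb_def by blast
    then show False using t by simp
  qed
  moreover have "wf_struct ar ?E" by (simp add: wf_struct_def)
  ultimately obtain f where "f \<in> embs ar ?E H" using univ by blast
  then have "inj f" "range f \<subseteq> verts H" by (auto simp: embs_def is_emb_def)
  then have "infinite (verts H)" using finite_subset finite_imageD infinite_UNIV_nat by blast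
  then show ?thesis using assms(1) by (auto simp: wf_struct_def)
qed

section \<open>From H through the tree structure back into H\<close>

lemma embs_rels:
  "e \<in> embs ar A B \<Longrightarrow> length t = ar R \<Longrightarrow> set t \<subseteq> verts A \<Longrightarrow> t \<in> rels A R \<longleftrightarrow> map e t \<in> rels B R"
  unfolding embs_def is_emb_def by blast

text \<open>On coded vertices the claims are true: by \<open>rd_copy_vnode\<close>, reading inside a
  copy returns the patterns of \<open>H\<close>.\<close>

lemma good_coded_image:
  fixes H :: "'r struct"
  assumes cod: "coded n (pnum ar H) lv kk K" and c: "copy m \<phi>"
    and g: "\<And>j. g j = to_nat (\<phi> (coded.vnode n (pnum ar H) lv kk [j]), rp j)" "strict_mono g"
    and rp: "\<And>j. same_unary ar H j (rp j)" and J: "finite J"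
  shows "good n ar H (g ` J) (inv g)"
proof -
  interpret coded n "pnum ar H" lv kk K by (rule cod)
  have ginj: "inj g" using g(2) by (rule strict_mono_imp_inj_on)
  have nodeg: "node (g j) = \<phi> (vnode [j])" and tagg: "tag (g j) = rp j" for j by (simp_all add: g(1))
  have levg: "lev (g j) = length (\<phi> (vnode [j]))" for j by (simp add: lev_def nodeg)
  have levg': "lev (g j) = m (lv j)" for j
    using copy_length[OF c vnode_in_T[of "[j]"]] by (simp add: levg len_def)
  have sml: "lev (g i) < lev (g j) \<longleftrightarrow> i < j" for i j
    using copy_strict_mono[OF c] lv_strict by (simp add: levg' strict_mono_less)
  have smg: "g i < g j \<longleftrightarrow> i < j" for i j using g(2) by (simp add: strict_mono_less)
  have cv: "cval n ar H S' = pnum ar H (inv g ` S')" if S': "S' \<subseteq> g ` J" "card S' \<ge> 2" for S'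
  proof -
    obtain J' where J': "J' \<subseteq> J" "S' = g ` J'" using S'(1) by (auto simp: subset_image_iff)
    have fJ': "finite J'" using J'(1) J finite_subset by blast
    have cJ: "card S' = card J'" using J'(2) ginj by (simp add: card_image inj_on_subset)
    obtain i js where L: "rev (sorted_list_of_set J') = i # js"
    proof (cases "rev (sorted_list_of_set J')")
      case Nil
      then have "J' = {}" using fJ' by simp
      then show ?thesis using S'(2) cJ by simp
    qed
    have sl: "sorted_list_of_set S' = map g (sorted_list_of_set J')"
      unfolding J'(2) using fJ' g(2) by (intro sorted_list_of_set_strict_mono_image) (auto simp: strict_mono_on_def smg)
    have len: "card J' = Suc (length js)" using arg_cong[OF L, of length] by simp
    have "sorted_wrt (>) (rev (sorted_list_of_set J'))" unfolding sorted_wrt_rev by simp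
    then have srt: "sorted_wrt (>) (i # js)" using L by simp
    have setJ: "set (i # js) = J'" using arg_cong[OF L, of set] fJ' by simp
    have "js \<noteq> []" using len cJ S'(2) by auto
    then have "dec n (pnum ar H) (Suc (length js)) (rd (\<phi> (vnode [i])) (map (\<lambda>j. length (\<phi> (vnode [j]))) js)) = pnum ar H J'"
      using rd_copy_vnode[OF c srt] setJ by simp
    moreover have "rev (sorted_list_of_set S') = g i # map g js" using L by (simp add: sl rev_map)
    ultimately have "cval n ar H S' = pnum ar H J'"
      using cJ len by (simp add: cval_def nodeg levg comp_def)
    moreover have "inv g ` S' = J'" unfolding J'(2) using ginj by (simp add: image_inv_f_f)
    ultimately show ?thesis by simp
  qed
  show ?thesis
    unfolding good_def
  proof (intro conjI ballI allI impI)
    show "finite (g ` J)" using J by simp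
    show "strict_mono_on (g ` J) lev" by (auto simp: strict_mono_on_def smg sml)
    show "strict_mono_on (g ` J) (inv g)" using ginj by (auto simp: strict_mono_on_def smg)
    show "same_unary ar H (inv g z) (tag z)" if "z \<in> g ` J" for z using that ginj rp by (auto simp: tagg)
    show "cval n ar H S' = pnum ar H (inv g ` S')" if "S' \<subseteq> g ` J" "2 \<le> card S'" for S' using cv that by simp
  qed
qed

lemma coded_self_embedding:
  fixes H :: "'r struct"
  assumes ar: "\<forall>R. ar R \<ge> 1" and fin: "\<forall>k \<ge> 2. finite {R. ar R = k}" and inj: "\<forall>R. injective_rel H R"
    and H: "verts H = UNIV"
    and cod: "coded n (pnum ar H) lv kk K" and c: "copy m \<phi>"
    and g: "\<And>j. g j = to_nat (\<phi> (coded.vnode n (pnum ar H) lv kk [j]), rp j)" "strict_mono g"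
    and rp: "\<And>j. same_unary ar H j (rp j)"
    and e: "e \<in> embs ar (tree_struct n ar H) H"
  shows "(\<lambda>j. e (g j)) \<in> embs ar H H"
proof -
  have ginj: "inj g" using g(2) by (rule strict_mono_imp_inj_on)
  have vT: "verts (tree_struct n ar H) = UNIV" by (simp add: tree_struct_def)
  have ei: "inj e" "mono e" and er: "\<And>R t. length t = ar R \<Longrightarrow> t \<in> rels (tree_struct n ar H) R \<longleftrightarrow> map e t \<in> rels H R"
    using e embs_rels[OF e] unfolding vT by (simp_all add: embs_def is_emb_def vT)
  have rel: "t \<in> rels H R \<longleftrightarrow> map (\<lambda>j. e (g j)) t \<in> rels H R" if t: "length t = ar R" for R t
  proof -
    have gd: "good n ar H (set (map g t)) (inv g)"
      using good_coded_image[OF cod c g rp, of "set t"] by simp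
    have id: "map (inv g) (map g t) = t" using ginj by (simp add: map_idI)
    have "t \<in> rels H R \<longleftrightarrow> map g t \<in> rels (tree_struct n ar H) R"
    proof
      assume "t \<in> rels H R"
      then have "map (inv g) (map g t) \<in> rels H R" by (simp only: id)
      then show "map g t \<in> rels (tree_struct n ar H) R"
        unfolding tree_struct_def snd_conv mem_Collect_eq using gd t by (intro conjI exI[of _ "inv g"]) simp_all
    next
      assume "map g t \<in> rels (tree_struct n ar H) R"
      then obtain h where h: "good n ar H (set (map g t)) h" "map h (map g t) \<in> rels H R"
        unfolding tree_struct_def snd_conv mem_Collect_eq by blast
      then have "map (inv g) (map g t) \<in> rels H R"
        using good_transfer[OF ar fin inj h(1) gd _ h(2)] t by simp
      then show "t \<in> rels H R" by (simp only: id)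
    qed
    also have "\<dots> \<longleftrightarrow> map e (map g t) \<in> rels H R" using er t by simp
    finally show ?thesis by (simp add: comp_def)
  qed
  have "inj (\<lambda>j. e (g j))" using inj_compose[OF ei(1) ginj] by (simp add: comp_def)
  moreover have "mono (\<lambda>j. e (g j))" using ei(2) g(2) by (simp add: mono_def strict_mono_less_eq)
  ultimately show ?thesis unfolding embs_def is_emb_def H mem_Collect_eq
    by (intro conjI allI impI rel) simp_all
qed

text \<open>Embeddings into the coded copy come from configurations, and their colour depends only
  on the type and on the positions of the \<open>a\<close> nodes in \<open>ds\<close>. The resulting
  bound \<open>card \<Theta>\<close> is fixed before the colouring.\<close>

lemma big_ramsey_tree:
  fixes H A :: "'r struct"
  assumes ar: "\<forall>R. ar R \<ge> 1" and fin: "\<forall>k \<ge> 2. finite {R. ar R = k}" and inj: "\<forall>R. injective_rel H R"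
    and H: "verts H = UNIV" and A: "verts A = {..<a}" and e0: "e0 \<in> embs ar A H"
    and emb: "embs ar (tree_struct (Suc a) ar H) H \<noteq> {}"
  shows "\<exists>l. big_ramsey_le ar A H l"
proof -
  \<comment> \<open>The successor ensures \<open>n \<ge> 1\<close> even for empty
    \<open>A\<close>.\<close>
  let ?n = "Suc a" and ?pv = "pnum ar H"
  obtain e where e: "e \<in> embs ar (tree_struct ?n ar H) H" using emb by blast
  \<comment> \<open>A canonical tag: vertices with the same unary relations get the same
    one.\<close>
  define rp where "rp j = (LEAST i. same_unary ar H j i)" for j
  have rp: "same_unary ar H j (rp j)" for j
    unfolding rp_def by (rule LeastI[of _ j]) (simp add: same_unary_def)
  have rp_eq: "rp i = rp j" if "same_unary ar H i j" for i j
  proof -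
    have "same_unary ar H i = same_unary ar H j" using that by (auto simp: same_unary_def fun_eq_iff)
    then show ?thesis by (simp add: rp_def)
  qed
  have finpv: "finite (?pv ` {J. finite J \<and> card J = k})" for k using finite_pnum[OF fin] .
  have "finite (\<Union>k\<le>?n. ?pv ` {J. finite J \<and> card J = k})" using finpv by simp
  then obtain b0 where "\<forall>x\<in>(\<Union>k\<le>?n. ?pv ` {J. finite J \<and> card J = k}). x \<le> b0"
    unfolding finite_nat_set_iff_bounded_le ..
  then have b0: "?pv J \<le> b0" if "finite J" "card J \<le> ?n" for J using that by blast
  define b where "b = b0 + 2"
  have b: "b \<ge> 2" "\<And>J. finite J \<Longrightarrow> card J \<le> ?n \<Longrightarrow> ?pv J < b" using b0 by (force simp: b_def)+
  let ?B = "Suc (2 ^ ?n)"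
  define \<Theta> where "\<Theta> = types ?B b \<times> {pos. set pos \<subseteq> {..<ds_bound ?B} \<and> length pos = a}"
  have fin\<Theta>: "finite \<Theta>" unfolding \<Theta>_def by (intro finite_cartesian_product finite_types finite_lists_length_eq) simp
  have "big_ramsey_le ar A H (card \<Theta>)"
    unfolding big_ramsey_le_def
  proof (intro allI impI)
    fix k and \<chi> :: "(nat \<Rightarrow> nat) \<Rightarrow> nat"
    assume \<chi>: "\<forall>e\<in>embs ar A H. \<chi> e < k"
    \<comment> \<open>The tags can be taken from \<open>e0\<close>, since vertex \<open>i\<close> of
      \<open>A\<close> has the same unary relations under every embedding.\<close>
    define mk where "mk zs = restrict (\<lambda>i. e (to_nat (zs ! i :: nd list, rp (e0 i)))) {..<a}" for zs
    define \<chi>' where "\<chi>' zs = (if mk zs \<in> embs ar A H then \<chi> (mk zs) else 0)" for zs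
    have "\<chi> e0 < k" using \<chi> e0 by blast
    then have \<chi>'k: "\<chi>' zs < k" for zs using \<chi> by (auto simp: \<chi>'_def)
    obtain m \<phi> where c: "copy m \<phi>" and hom: "\<forall>(\<tau>, pos)\<in>\<Theta>. \<exists>c. \<forall>(ds, as)\<in>reachable \<tau>. (\<forall>i\<in>set pos. i < length ds) \<longrightarrow>
       \<chi>' (map (\<lambda>i. \<phi> (ds ! i)) pos) = c"
      using ramsey_types[where \<chi> = \<chi>' and k = k, OF \<chi>'k fin\<Theta>] by (elim exE conjE) (rule that)
    have "\<forall>p\<in>\<Theta>. \<exists>c. \<forall>(ds, as)\<in>reachable (fst p). (\<forall>i\<in>set (snd p). i < length ds) \<longrightarrow> \<chi>' (map (\<lambda>i. \<phi> (ds ! i)) (snd p)) = c"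
      using hom by (simp add: case_prod_unfold)
    then obtain col where col: "\<forall>p\<in>\<Theta>. \<forall>(ds, as)\<in>reachable (fst p). (\<forall>i\<in>set (snd p). i < length ds) \<longrightarrow>
       \<chi>' (map (\<lambda>i. \<phi> (ds ! i)) (snd p)) = col p" unfolding bchoice_iff ..
    have col': "\<chi>' (map (\<lambda>i. \<phi> (ds ! i)) pos) = col (\<tau>, pos)"
      if "(\<tau>, pos) \<in> \<Theta>" "(ds, as) \<in> reachable \<tau>" "\<forall>i\<in>set pos. i < length ds" for \<tau> pos ds as
      using bspec[OF bspec[OF col that(1)], of "(ds, as)"] that by simp

    \<comment> \<open>\<open>M j L\<close> bounds the numbers of all images of nodes of level
      \<open>L\<close> with the tag of \<open>j\<close>, and every vertex with number at most
      \<open>M j L\<close> has level below \<open>Z j L\<close>. A coded vertex of level at least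
      \<open>Z j L\<close> therefore has a larger number.\<close>
    define M where "M j L = Max (insert 0 ((\<lambda>x. to_nat (\<phi> x, rp j)) ` Tl L))" for j L
    define Z where "Z j L = Suc (Max (lev ` {..M j L}))" for j L
    obtain lv kk K where cod: "coded ?n ?pv lv kk K" and lvZ: "\<And>j. Z j (lv j) \<le> lv (Suc j)"
      using coded_exists[where pv = ?pv and n = ?n and Z = Z, OF finpv] by auto
    interpret coded ?n ?pv lv kk K by (rule cod)
    define g where "g j = to_nat (\<phi> (vnode [j]), rp j)" for j
    have yT: "vnode [j] \<in> Tl (lv j)" for j using vnode_in_T[of "[j]"] by (simp add: Tl_def len_def)
    have "g j < g (Suc j)" for j
    proof (rule ccontr)
      assume n: "\<not> g j < g (Suc j)"
      have "g j \<le> M j (lv j)"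
        unfolding M_def g_def using yT finite_Tl by (intro Max_ge) auto
      then have "g (Suc j) \<in> {..M j (lv j)}" using n by simp
      then have "lev (g (Suc j)) < Z j (lv j)" unfolding Z_def less_Suc_eq_le by (intro Max_ge) auto
      moreover have "lev (g (Suc j)) = m (lv (Suc j))"
        using yT[of "Suc j"] copy_length[OF c, of "vnode [Suc j]"] by (simp add: g_def lev_def Tl_def)
      moreover have "lv (Suc j) \<le> m (lv (Suc j))" using copy_strict_mono[OF c] by (rule strict_mono_imp_increasing)
      ultimately show False using lvZ[of j] by linarith
    qed
    then have gm: "strict_mono g" by (simp add: strict_mono_Suc_iff)
    let ?f = "\<lambda>j. e (g j)"
    have f: "?f \<in> embs ar H H"
      by (rule coded_self_embedding[OF ar fin inj H cod c _ gm rp e]) (simp add: g_def)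
    have "\<chi> ` {e' \<in> embs ar A H. e' ` verts A \<subseteq> ?f ` verts H} \<subseteq> col ` \<Theta>"
    proof
      fix v assume "v \<in> \<chi> ` {e' \<in> embs ar A H. e' ` verts A \<subseteq> ?f ` verts H}"
      then obtain e' where e': "e' \<in> embs ar A H" "e' ` {..<a} \<subseteq> range ?f" "v = \<chi> e'" using A H by auto
      have "\<forall>i\<in>{..<a}. \<exists>j. e' i = ?f j" using e'(2) by blast
      then obtain jj where jj: "\<And>i. i < a \<Longrightarrow> e' i = ?f (jj i)" unfolding bchoice_iff by auto
      have un: "rp (e0 i) = rp (jj i)" if i: "i < a" for i
      proof (rule rp_eq)
        have "[e0 i] \<in> rels H R \<longleftrightarrow> [jj i] \<in> rels H R" if R: "ar R = 1" for R
        proof -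
          have "[i] \<in> rels A R \<longleftrightarrow> map e0 [i] \<in> rels H R" "[i] \<in> rels A R \<longleftrightarrow> map e' [i] \<in> rels H R"
            using embs_rels[OF e0, of "[i]" R] embs_rels[OF e'(1), of "[i]" R] R i A by simp_all
          moreover have "[jj i] \<in> rels H R \<longleftrightarrow> map ?f [jj i] \<in> rels H R"
            using embs_rels[OF f, of "[jj i]" R] R H by simp
          ultimately show ?thesis using jj[OF i] by simp
        qed
        then show "same_unary ar H (e0 i) (jj i)" by (simp add: same_unary_def)
      qed
      let ?I = "jj ` {..<a}"
      have "finite ?I" "card ?I \<le> ?n" using card_image_le[of "{..<a}" jj] by auto
      from conf_type[OF this b] obtain \<tau> ds as where ty: "\<tau> \<in> types ?B b" "(ds, as) \<in> reachable \<tau>"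
        "\<forall>i\<in>?I. vnode [i] \<in> set ds" "length ds \<le> ds_bound ?B" by blast
      have "\<forall>i\<in>{..<a}. \<exists>q. q < length ds \<and> ds ! q = vnode [jj i]" using ty(3) by (auto simp: in_set_conv_nth)
      then obtain q where q: "\<And>i. i < a \<Longrightarrow> q i < length ds \<and> ds ! q i = vnode [jj i]" unfolding bchoice_iff by auto
      define pos where "pos = map q [0..<a]"
      have pos: "\<forall>i\<in>set pos. i < length ds" using q by (auto simp: pos_def)
      have "set pos \<subseteq> {..<ds_bound ?B}" using pos ty(4) by (auto intro: less_le_trans)
      then have \<Theta>: "(\<tau>, pos) \<in> \<Theta>" using ty(1) by (simp add: \<Theta>_def pos_def)
      have "mk (map (\<lambda>i. \<phi> (ds ! i)) pos) = e'"
      proof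
        fix i show "mk (map (\<lambda>i. \<phi> (ds ! i)) pos) i = e' i"
        proof (cases "i < a")
          case True
          then show ?thesis using q[OF True] jj[OF True] un[OF True] by (simp add: mk_def pos_def g_def)
        next
          case False
          then have "e' i = undefined" using e'(1) A by (auto simp: embs_def is_emb_def extensional_def)
          then show ?thesis using False by (simp add: mk_def)
        qed
      qed
      then have "\<chi>' (map (\<lambda>i. \<phi> (ds ! i)) pos) = v" using e' by (simp add: \<chi>'_def)
      then have "v = col (\<tau>, pos)" using col'[OF \<Theta> ty(2) pos] by simp
      then show "v \<in> col ` \<Theta>" using \<Theta> by blast
    qed
    then have "card (\<chi> ` {e' \<in> embs ar A H. e' ` verts A \<subseteq> ?f ` verts H}) \<le> card \<Theta>"
      using fin\<Theta> by (meson card_image_le card_mono finite_imageI order_trans)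
    then show "\<exists>f\<in>embs ar H H. card (\<chi> ` {e' \<in> embs ar A H. e' ` verts A \<subseteq> f ` verts H}) \<le> card \<Theta>"
      using f by blast
  qed
  then show ?thesis by blast
qed

theorem theorem1p1:
  fixes ar :: "'r \<Rightarrow> nat" and H :: "'r struct"
  assumes "\<forall>R. ar R \<ge> 1"
    and "\<forall>k \<ge> 2. finite {R. ar R = k}"
    and "countable {R. ar R = 1}"
    and "wf_struct ar H"
    and "unrestricted ar H"
    and "\<forall>R. injective_rel H R"
  shows "finite_big_ramsey_degrees ar H"
proof -
  obtain \<F> where F: "\<forall>F \<in> \<F>. finite_struct ar F \<and> covered_by_relation F" "free_of ar \<F> H"
    and univ: "\<forall>A. wf_struct ar A \<and> free_of ar \<F> A \<longrightarrow> embs ar A H \<noteq> {}"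
    using assms(5) unfolding unrestricted_def by (elim exE conjE) (rule that)
  have H: "verts H = UNIV" by (rule universal_infinite[OF assms(4) F(1) univ])
  show ?thesis
    unfolding finite_big_ramsey_degrees_def
  proof (intro allI impI)
    fix A :: "'r struct" assume A: "finite_struct ar A \<and> embs ar A H \<noteq> {}"
    then obtain e0 where e0: "e0 \<in> embs ar A H" by blast
    have "(\<exists>a. verts A = {..<a}) \<or> verts A = UNIV" "finite (verts A)"
      using A by (auto simp: finite_struct_def wf_struct_def)
    then obtain a where a: "verts A = {..<a}" by auto
    have "free_of ar \<F> (tree_struct (Suc a) ar H)"
      by (rule tree_struct_free[OF assms(1,2,6) H F])
    then have "embs ar (tree_struct (Suc a) ar H) H \<noteq> {}" using univ wf_tree_struct by blast
    then show "\<exists>l. big_ramsey_le ar A H l"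
      by (rule big_ramsey_tree[OF assms(1,2,6) H a e0])
  qed
qed

end
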